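(* Let $n,t,k$ be positive integers with $n,t\ge 2$ and $k\ge 3$, and assume that $n=d+kt$ for an integer $d$ with $1\le d\le t$. Let $\ell_1$ be an integer with $3\le \ell_1\le k+\left\lfloor\frac{d-2}{t}\right\rfloor+1$. Let $K$ be a field and $S=K[x_1,\dots,x_n]$. Let $I\subset S$ be a $t$-spread strongly stable ideal all of whose extremal Betti numbers are equal to $1$ (that is, $I\in\mathcal{S}_{t,n,\mathbf{1}}$), of initial degree $\ell_1$, and having a corner in degree $\ell_1$ (that is, a corner of the form $(k_1,\ell_1)$ for some $k_1$). Then $I$ has at most $$k+\left\lfloor\frac{d-2}{t}\right\rfloor-(\ell_1-2)$$ corners.
   Context: $S=K[x_1,\dots,x_n]$ is the standard graded polynomial ring over a field $K$ ($\deg x_i=1$). Let $t\ge 1$. A monomial $x_{i_1}x_{i_2}\cdots x_{i_d}$ with $1\le i_1\le\dots\le i_d\le n$ is called $t$-spread if $i_{j+1}-i_j\ge t$ for all $j=1,\dots,d-1$. A monomial ideal is a $t$-spread monomial ideal if it is generated by $t$-spread monomials. For a monomial $u$, $\mathrm{supp}(u)=\{i: x_i \text{ divides } u\}$. A $t$-spread monomial ideal $I$ is $t$-spread strongly stable if for all $t$-spread monomials $u\in I$, all $j\in\mathrm{supp}(u)$ and all $i<j$ such that $x_i(u/x_j)$ is $t$-spread, one has $x_i(u/x_j)\in I$. The initial degree of a nonzero graded ideal $I$ is the minimum $j$ such that the degree-$j$ component $I_j$ is nonzero. The graded Betti numbers of $I$ are $\beta_{i,i+j}(I)=\dim_K \mathrm{Tor}^S_i(I,K)_{i+j}$.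 A graded Betti number $\beta_{k,k+\ell}(I)\neq 0$ is called extremal if $\beta_{i,i+j}(I)=0$ for all $i\ge k$, $j\ge \ell$ with $(i,j)\ne(k,\ell)$; the pair $(k,\ell)$ is then called a corner of $I$ (in degree $\ell$). The corners of $I$ are listed as $(k_1,\ell_1),\dots,(k_r,\ell_r)$ with $n-1\ge k_1>k_2>\dots>k_r\ge 1$ and $1\le\ell_1<\ell_2<\dots<\ell_r$. $\mathcal{S}_{t,n,\mathbf 1}$ denotes the set of $t$-spread strongly stable ideals $I$ of $S$ such that $\beta_{k,k+\ell}(I)=1$ for every corner $(k,\ell)$ of $I$. *)

theory Defs
  imports
    "HOL-Library.Poly_Mapping"
    "HOL-Algebra.Ideal"
    "Jordan_Normal_Form.VS_Connect"
begin

section \<open>Polynomial rings\<close>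

text \<open>Exponent vectors are finitely supported maps from variable indices to exponents, so that
  \<open>u + v\<close> is the product of monomials and \<open>Poly_Mapping.keys u\<close> is the support of \<open>u\<close>.\<close>

type_synonym monomial = "nat \<Rightarrow>\<^sub>0 nat"

type_synonym 'k mpoly = "monomial \<Rightarrow>\<^sub>0 'k"

abbreviation mono_poly :: "monomial \<Rightarrow> 'k::field mpoly"
  where "mono_poly u \<equiv> Poly_Mapping.single u 1"

definition mdeg :: "monomial \<Rightarrow> nat"
  where "mdeg u = (\<Sum>i\<in>Poly_Mapping.keys u. Poly_Mapping.lookup u i)"

definition poly_ring :: "nat \<Rightarrow> 'k::field mpoly ring"
  where "poly_ring n =
    \<lparr>carrier = {p. \<forall>u\<in>Poly_Mapping.keys p. Poly_Mapping.keys u \<subseteq> {1..n}},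
     mult = (*), one = 1, zero = 0, add = (+)\<rparr>"

definition graded_component :: "'k::field mpoly set \<Rightarrow> nat \<Rightarrow> 'k mpoly set"
  where "graded_component I j = {p \<in> I. \<forall>u\<in>Poly_Mapping.keys p. mdeg u = j}"

text \<open>Meaningful for nonzero graded ideals only.\<close>

definition initial_degree :: "'k::field mpoly set \<Rightarrow> nat"
  where "initial_degree I = (LEAST j. graded_component I j \<noteq> {0})"


section \<open>\<open>t\<close>-spread strongly stable ideals\<close>

definition tspread :: "nat \<Rightarrow> nat \<Rightarrow> monomial \<Rightarrow> bool"
  where "tspread t n u \<longleftrightarrow>
    (\<exists>is. sorted is \<and> set is \<subseteq> {1..n} \<and>
          u = sum_list (map (\<lambda>i. Poly_Mapping.single i 1) is) \<and>
          (\<forall>j. Suc j < length is \<longrightarrow> is ! j + t \<le> is ! Suc j))"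

definition tspread_monomial_ideal :: "nat \<Rightarrow> nat \<Rightarrow> 'k::field mpoly set \<Rightarrow> bool"
  where "tspread_monomial_ideal t n I \<longleftrightarrow>
    (\<exists>U \<subseteq> {u. tspread t n u}. I = Idl\<^bsub>poly_ring n\<^esub> (mono_poly ` U))"

definition tspread_strongly_stable :: "nat \<Rightarrow> nat \<Rightarrow> 'k::field mpoly set \<Rightarrow> bool"
  where "tspread_strongly_stable t n I \<longleftrightarrow>
    tspread_monomial_ideal t n I \<and>
    (\<forall>u j i. tspread t n u \<longrightarrow> mono_poly u \<in> I \<longrightarrow>
       j \<in> Poly_Mapping.keys u \<longrightarrow> 1 \<le> i \<longrightarrow> i < j \<longrightarrow>
       tspread t n (u - Poly_Mapping.single j 1 + Poly_Mapping.single i 1) \<longrightarrow>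
       mono_poly (u - Poly_Mapping.single j 1 + Poly_Mapping.single i 1) \<in> I)"


section \<open>Graded free resolutions and Tor\<close>

text \<open>A graded free resolution
  \<open>\<dots> \<rightarrow> F\<^sub>2 \<rightarrow> F\<^sub>1 \<rightarrow> F\<^sub>0 \<rightarrow> I \<rightarrow> 0\<close> by finitely generated graded free modules, in coordinates:
  \<open>F\<^sub>i\<close> is the direct sum of the modules \<open>S(-a)\<close>, with \<open>a\<close> running through the list \<open>a i\<close>, the
  matrix \<open>A 0\<close> is the augmentation \<open>F\<^sub>0 \<rightarrow> I \<subseteq> S\<close>, and \<open>A (Suc i)\<close> is the differential
  \<open>F\<^sub>i\<^sub>+\<^sub>1 \<rightarrow> F\<^sub>i\<close>. Shifts are natural numbers because an ideal lives in nonnegative degrees.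
  The resolution may have infinite length and need not be minimal.\<close>

definition target_shifts :: "(nat \<Rightarrow> nat list) \<Rightarrow> nat \<Rightarrow> nat list"
  where "target_shifts a i = (case i of 0 \<Rightarrow> [0] | Suc j \<Rightarrow> a j)"

definition free_module :: "nat \<Rightarrow> nat \<Rightarrow> 'k::field mpoly vec set"
  where "free_module n r = {v \<in> carrier_vec r. \<forall>b<r. v $ b \<in> carrier (poly_ring n)}"

text \<open>A nonzero entry in row \<open>b\<close> and column \<open>c\<close> of a degree-preserving map is homogeneous of
  degree (shift of column \<open>c\<close>) - (shift of row \<open>b\<close>).\<close>

definition graded_free_resolution ::
  "nat \<Rightarrow> 'k::field mpoly set \<Rightarrow> (nat \<Rightarrow> nat list) \<Rightarrow> (nat \<Rightarrow> 'k mpoly mat) \<Rightarrow> bool"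
  where "graded_free_resolution n I a A \<longleftrightarrow>
    (\<forall>i. A i \<in> carrier_mat (length (target_shifts a i)) (length (a i))) \<and>
    (\<forall>i. \<forall>b<length (target_shifts a i). \<forall>c<length (a i).
       A i $$ (b, c) \<in> carrier (poly_ring n) \<and>
       (\<forall>u\<in>Poly_Mapping.keys (A i $$ (b, c)). mdeg u + target_shifts a i ! b = a i ! c)) \<and>
    (\<lambda>v. (A 0 *\<^sub>v v) $ 0) ` free_module n (length (a 0)) = I \<and>
    (\<forall>i. (\<lambda>v. A (Suc i) *\<^sub>v v) ` free_module n (length (a (Suc i))) =
         {v \<in> free_module n (length (a i)). A i *\<^sub>v v = 0\<^sub>v (length (target_shifts a i))})"

text \<open>Tensoring with \<open>K = S/(x\<^sub>1,\<dots>,x\<^sub>n)\<close> turns \<open>F\<^sub>i\<close> into \<open>K\<^sup>r\<close> with \<open>r = length (a i)\<close>, and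
  replaces every matrix entry by its constant coefficient. The basis vector \<open>c\<close> has degree
  \<open>a i ! c\<close>.\<close>

definition residue_mat :: "'k::field mpoly mat \<Rightarrow> 'k mat"
  where "residue_mat M = map_mat (\<lambda>p. Poly_Mapping.lookup p 0) M"

definition fibre_component :: "(nat \<Rightarrow> nat list) \<Rightarrow> nat \<Rightarrow> nat \<Rightarrow> 'k::field vec set"
  where "fibre_component a i e =
    {v \<in> carrier_vec (length (a i)). \<forall>c<length (a i). v $ c \<noteq> 0 \<longrightarrow> a i ! c = e}"

text \<open>The augmentation \<open>A 0\<close> is not part of the complex \<open>F \<otimes> K\<close>: in homological degree 0 every
  element is a cycle.\<close>

definition tor_cycles ::
  "(nat \<Rightarrow> nat list) \<Rightarrow> (nat \<Rightarrow> 'k::field mpoly mat) \<Rightarrow> nat \<Rightarrow> nat \<Rightarrow> 'k vec set"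
  where "tor_cycles a A i e =
    {v \<in> fibre_component a i e.
       i > 0 \<longrightarrow> residue_mat (A i) *\<^sub>v v = 0\<^sub>v (length (target_shifts a i))}"

definition tor_boundaries ::
  "(nat \<Rightarrow> nat list) \<Rightarrow> (nat \<Rightarrow> 'k::field mpoly mat) \<Rightarrow> nat \<Rightarrow> nat \<Rightarrow> 'k vec set"
  where "tor_boundaries a A i e =
    (\<lambda>v. residue_mat (A (Suc i)) *\<^sub>v v) ` fibre_component a (Suc i) e"

definition subspace_dim :: "nat \<Rightarrow> 'k::field vec set \<Rightarrow> nat"
  where "subspace_dim r W =
    vectorspace.dim (class_ring :: 'k ring) (module_vec TYPE('k) r \<lparr>carrier := W\<rparr>)"

text \<open>The dimension of the degree \<open>e\<close> part of the homology of \<open>F \<otimes> K\<close> at \<open>F\<^sub>i \<otimes> K\<close>. The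
  boundaries form a subspace of the finite-dimensional space of cycles, so the subtraction does
  not truncate and gives the dimension of the quotient.\<close>

definition tor_dim ::
  "(nat \<Rightarrow> nat list) \<Rightarrow> (nat \<Rightarrow> 'k::field mpoly mat) \<Rightarrow> nat \<Rightarrow> nat \<Rightarrow> nat"
  where "tor_dim a A i e =
    subspace_dim (length (a i)) (tor_cycles a A i e) -
    subspace_dim (length (a i)) (tor_boundaries a A i e)"

text \<open>\<open>betti n I i e\<close> is \<open>dim\<^sub>K Tor\<^sub>i(I, K)\<^sub>e\<close>, where \<open>e\<close> is the internal degree, computed from an
  arbitrarily chosen graded free resolution of \<open>I\<close>, as in the definition of a derived functor.\<close>

definition betti :: "nat \<Rightarrow> 'k::field mpoly set \<Rightarrow> nat \<Rightarrow> nat \<Rightarrow> nat"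
  where "betti n I i e =
    (let (a, A) = (SOME (a, A). graded_free_resolution n I a A) in tor_dim a A i e)"


section \<open>Corners\<close>

definition corners :: "nat \<Rightarrow> 'k::field mpoly set \<Rightarrow> (nat \<times> nat) set"
  where "corners n I =
    {(k, l). betti n I k (k + l) \<noteq> 0 \<and>
       (\<forall>i\<ge>k. \<forall>j\<ge>l. (i, j) \<noteq> (k, l) \<longrightarrow> betti n I i (i + j) = 0)}"

definition unit_extremal_ideals :: "nat \<Rightarrow> nat \<Rightarrow> 'k::field mpoly set set"
  where "unit_extremal_ideals t n =
    {I. tspread_strongly_stable t n I \<and> (\<forall>(k, l)\<in>corners n I. betti n I k (k + l) = 1)}"

end

theory Submission
  imports Defs
begin

text \<open>Order the \<open>t\<close>-spread monomials of \<open>I\<close> by the sum of their indices. Strong stability says that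
  each of them has a colon ideal generated by variables with respect to its predecessors, so iterated
  mapping cones give a graded free resolution of \<open>I\<close> in which a generator of degree \<open>\<ell>\<close> contributes to
  homological degree \<open>i\<close> only in degree \<open>i + \<ell>\<close>. Comparing it with an arbitrary resolution,
  \<open>\<beta>\<^sub>i\<^sub>,\<^sub>i\<^sub>+\<^sub>\<ell>(I) = 0\<close> unless \<open>\<ell>\<close> is the degree of a \<open>t\<close>-spread monomial needed to generate \<open>I\<close>. Since
  \<open>(\<ell> - 1)t < n\<close>, such a degree is at most \<open>k + 1\<close>. If \<open>d = 1\<close>, the only \<open>t\<close>-spread monomial of degree
  \<open>k + 1\<close> is the smallest one, and it is a multiple of the smallest monomial of degree \<open>\<ell>\<^sub>1\<close>, which lies
  in \<open>I\<close>; so it is not needed. Finally, by extremality each degree carries at most one corner.\<close>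

text \<open>\<open>betti\<close> is read off a resolution picked by choice, so nothing is known
  beforehand about its shifts. Independence of Tor from the resolution is not proved in full; the
  comparison yields just a vanishing statement: if some resolution has no basis element of degree
  \<open>e\<close> in homological degree \<open>i\<close>, then on the degree \<open>e\<close> part
  of the fibre of any other one the identity is null-homotopic, so cycles are boundaries there.
  Hence the mapping cones may be far from minimal: a list of shifts that bounds the possible degrees
  suffices.

  The index sum does not separate monomials, but the exchange behind the colon ideals always reaches
  a strictly smaller sum, so ties may be ordered arbitrarily. The exchange also never raises the
  degree, so the generating set may be cut off at any degree \<open>D\<close> above which it is
  redundant. The theorem takes \<open>D = k\<close> if \<open>d = 1\<close> and
  \<open>D = k + 1\<close> otherwise. Since \<open>l1\<close> is the initial degree, corner degrees
  lie in \<open>{l1..D}\<close>; the floor equals \<open>D - k - 1\<close>, so the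
  \<open>D + 1 - l1\<close> possible values are exactly the claimed bound.\<close>

abbreviation poly_carrier :: "nat \<Rightarrow> 'k::field mpoly set"
  where "poly_carrier n \<equiv> carrier (poly_ring n)"

section \<open>Closure properties of the polynomial ring and additivity of the degree\<close>

lemma poly_carrier_iff:
  "p \<in> poly_carrier n \<longleftrightarrow> (\<forall>m\<in>Poly_Mapping.keys p. Poly_Mapping.keys m \<subseteq> {1..n})"
  by (simp add: poly_ring_def)

lemma keys_add_nat: "Poly_Mapping.keys (u + v :: monomial) = Poly_Mapping.keys u \<union> Poly_Mapping.keys v"
  by (auto simp: in_keys_iff lookup_add)

lemma poly_carrier_zero [simp, intro]: "0 \<in> poly_carrier n"
  and poly_carrier_one [simp, intro]: "1 \<in> poly_carrier n"
  by (simp_all add: poly_carrier_iff)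

lemma poly_carrier_add [intro]: "p \<in> poly_carrier n \<Longrightarrow> q \<in> poly_carrier n \<Longrightarrow> p + q \<in> poly_carrier n"
  using Poly_Mapping.keys_add[of p q] by (fastforce simp: poly_carrier_iff)

lemma poly_carrier_uminus [intro]: "p \<in> poly_carrier n \<Longrightarrow> - p \<in> poly_carrier n"
  by (simp add: poly_carrier_iff in_keys_iff)

lemma poly_carrier_minus [intro]: "p \<in> poly_carrier n \<Longrightarrow> q \<in> poly_carrier n \<Longrightarrow> p - q \<in> poly_carrier n"
  using poly_carrier_add[of p n "- q"] poly_carrier_uminus[of q n] by simp

lemma poly_carrier_mult [intro]: "p \<in> poly_carrier n \<Longrightarrow> q \<in> poly_carrier n \<Longrightarrow> p * q \<in> poly_carrier n"
  using Poly_Mapping.keys_mult[of p q] by (fastforce simp: poly_carrier_iff keys_add_nat)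

lemma poly_carrier_sum: "(\<And>x. x \<in> X \<Longrightarrow> f x \<in> poly_carrier n) \<Longrightarrow> sum f X \<in> poly_carrier n"
  by (induction X rule: infinite_finite_induct) auto

lemma mdeg_alt: "finite X \<Longrightarrow> Poly_Mapping.keys u \<subseteq> X \<Longrightarrow> mdeg u = (\<Sum>i\<in>X. Poly_Mapping.lookup u i)"
  unfolding mdeg_def by (rule sum.mono_neutral_left) (auto simp: in_keys_iff)

lemma mdeg_add [simp]: "mdeg (u + v) = mdeg u + mdeg v"
proof -
  let ?X = "Poly_Mapping.keys u \<union> Poly_Mapping.keys v"
  have "mdeg (u + v) = (\<Sum>i\<in>?X. Poly_Mapping.lookup (u + v) i)"
    by (rule mdeg_alt) (auto simp: keys_add_nat)
  also have "\<dots> = mdeg u + mdeg v"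
    by (simp add: lookup_add sum.distrib mdeg_alt[of ?X])
  finally show ?thesis .
qed

lemma mdeg_zero [simp]: "mdeg 0 = 0"
  by (simp add: mdeg_def)

lemma mdeg_single [simp]: "mdeg (Poly_Mapping.single i e) = e"
  by (simp add: mdeg_def)


section \<open>Homogeneous matrices\<close>

text \<open>The degree \<open>e\<close> component of an element of the twisted module S(-s). Writing
  the condition as a sum rather than with \<open>e - s\<close> gives 0 for \<open>e < s\<close>,
  where natural subtraction would truncate.\<close>

definition hpart :: "nat \<Rightarrow> nat \<Rightarrow> 'k::field mpoly \<Rightarrow> 'k mpoly"
  where "hpart e s p = Poly_Mapping.mapp (\<lambda>m c. c when mdeg m + s = e) p"

lemma lookup_hpart: "Poly_Mapping.lookup (hpart e s p) m = (Poly_Mapping.lookup p m when mdeg m + s = e)"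
  by (auto simp: hpart_def lookup_mapp in_keys_iff when_def)

lemma keys_hpart: "Poly_Mapping.keys (hpart e s p) = {m \<in> Poly_Mapping.keys p. mdeg m + s = e}"
  by (auto simp: in_keys_iff lookup_hpart when_def split: if_splits)

lemma hpart_zero [simp]: "hpart e s 0 = 0"
  by (rule poly_mapping_eqI) (simp add: lookup_hpart)

lemma hpart_add: "hpart e s (p + q) = hpart e s p + hpart e s q"
  by (rule poly_mapping_eqI) (simp add: lookup_hpart lookup_add when_def)

lemma hpart_sum: "hpart e s (sum f X) = (\<Sum>x\<in>X. hpart e s (f x))"
  by (induction X rule: infinite_finite_induct) (simp_all add: hpart_add)

lemma hpart_ident:
  assumes "\<And>m. m \<in> Poly_Mapping.keys p \<Longrightarrow> mdeg m + s = e"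
  shows "hpart e s p = p"
  by (rule poly_mapping_eqI) (use assms in \<open>auto simp: lookup_hpart when_def in_keys_iff\<close>)

text \<open>A form of degree \<open>s' - s\<close> is a degree-preserving map from S(-s') to S(-s),
  hence commutes with taking the component of degree \<open>e\<close>.\<close>

lemma hpart_mult:
  assumes "\<And>m. m \<in> Poly_Mapping.keys p \<Longrightarrow> mdeg m + s = s'"
  shows "hpart e s (p * q) = p * hpart e s' q"
proof (rule poly_mapping_eqI)
  fix m
  \<comment> \<open>For \<open>l\<close> in the support of \<open>p\<close>, the equation
    \<open>m = l + r\<close> turns the degree condition on \<open>r\<close> into one on
    \<open>m\<close> alone, which can leave the inner sum.\<close>
  have eq: "Poly_Mapping.lookup p l * (\<Sum>r. Poly_Mapping.lookup (hpart e s' q) r when m = l + r) =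
    (if mdeg m + s = e then Poly_Mapping.lookup p l * (\<Sum>r. Poly_Mapping.lookup q r when m = l + r) else 0)" for l
  proof (cases "l \<in> Poly_Mapping.keys p")
    case True
    then have "mdeg r + s' = e \<longleftrightarrow> mdeg m + s = e" if "m = l + r" for r
      using assms[OF True] that by auto
    then have "(Poly_Mapping.lookup (hpart e s' q) r when m = l + r) =
        (if mdeg m + s = e then (Poly_Mapping.lookup q r when m = l + r) else 0)" for r
      by (auto simp: lookup_hpart when_def)
    then show ?thesis by (cases "mdeg m + s = e") simp_all
  qed (simp add: in_keys_iff)
  show "Poly_Mapping.lookup (hpart e s (p * q)) m = Poly_Mapping.lookup (p * hpart e s' q) m"
    unfolding lookup_mult eq unfolding lookup_hpart lookup_mult by (cases "mdeg m + s = e") simp_all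
qed

text \<open>The entry condition of \<open>graded_free_resolution\<close>, isolated so that chain
  maps and homotopies can also be required to preserve degrees; \<open>rs\<close> are the shifts of
  the target and \<open>cs\<close> those of the source.\<close>

definition gmat :: "nat \<Rightarrow> nat list \<Rightarrow> nat list \<Rightarrow> 'k::field mpoly mat \<Rightarrow> bool"
  where "gmat n rs cs M \<longleftrightarrow> M \<in> carrier_mat (length rs) (length cs) \<and>
    (\<forall>b<length rs. \<forall>c<length cs. M $$ (b, c) \<in> poly_carrier n \<and>
       (\<forall>u\<in>Poly_Mapping.keys (M $$ (b, c)). mdeg u + rs ! b = cs ! c))"

lemma gmatI:
  assumes "M \<in> carrier_mat (length rs) (length cs)"
    and "\<And>b c. b < length rs \<Longrightarrow> c < length cs \<Longrightarrow> M $$ (b, c) \<in> poly_carrier n"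
    and "\<And>b c u. b < length rs \<Longrightarrow> c < length cs \<Longrightarrow> u \<in> Poly_Mapping.keys (M $$ (b, c)) \<Longrightarrow>
      mdeg u + rs ! b = cs ! c"
  shows "gmat n rs cs M"
  using assms by (auto simp: gmat_def)

lemma gmat_carrier [dest]: "gmat n rs cs M \<Longrightarrow> M \<in> carrier_mat (length rs) (length cs)"
  by (simp add: gmat_def)

lemma gmat_entry:
  assumes "gmat n rs cs M" "b < length rs" "c < length cs"
  shows "M $$ (b, c) \<in> poly_carrier n"
    and "u \<in> Poly_Mapping.keys (M $$ (b, c)) \<Longrightarrow> mdeg u + rs ! b = cs ! c"
  using assms by (auto simp: gmat_def)

lemma gmat_mult:
  assumes A: "gmat n rs ms A" and B: "gmat n ms cs B"
  shows "gmat n rs cs (A * B)"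
proof (rule gmatI)
  have cA: "A \<in> carrier_mat (length rs) (length ms)" and cB: "B \<in> carrier_mat (length ms) (length cs)"
    using A B by auto
  then show "A * B \<in> carrier_mat (length rs) (length cs)" by simp
  fix b c assume bc: "b < length rs" "c < length cs"
  have entry: "(A * B) $$ (b, c) = (\<Sum>j<length ms. A $$ (b, j) * B $$ (j, c))"
    using cA cB bc by (auto simp: scalar_prod_def lessThan_atLeast0)
  show "(A * B) $$ (b, c) \<in> poly_carrier n"
    unfolding entry using bc by (auto intro!: poly_carrier_sum gmat_entry[OF A] gmat_entry[OF B])
  fix u assume "u \<in> Poly_Mapping.keys ((A * B) $$ (b, c))"
  then obtain j where "j < length ms" "u \<in> Poly_Mapping.keys (A $$ (b, j) * B $$ (j, c))"
    using Poly_Mapping.keys_sum[of "\<lambda>j. A $$ (b, j) * B $$ (j, c)" "{..<length ms}"]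
    unfolding entry by auto
  then obtain v w where "u = v + w" "v \<in> Poly_Mapping.keys (A $$ (b, j))" "w \<in> Poly_Mapping.keys (B $$ (j, c))"
    using Poly_Mapping.keys_mult[of "A $$ (b, j)" "B $$ (j, c)"] by auto
  then show "mdeg u + rs ! b = cs ! c"
    using gmat_entry(2)[OF A bc(1) \<open>j < length ms\<close>] gmat_entry(2)[OF B \<open>j < length ms\<close> bc(2)]
    by fastforce
qed

lemma gmat_uminus:
  assumes A: "gmat n rs cs A"
  shows "gmat n rs cs (- A)"
proof -
  have "A \<in> carrier_mat (length rs) (length cs)" using A by auto
  moreover have "Poly_Mapping.keys (- p) = Poly_Mapping.keys p" for p :: "'a mpoly"
    by (simp add: in_keys_iff set_eq_iff)
  ultimately show ?thesis
    by (auto intro!: gmatI poly_carrier_uminus simp: gmat_entry[OF A])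
qed

lemma gmat_minus:
  assumes A: "gmat n rs cs A" and B: "gmat n rs cs B"
  shows "gmat n rs cs (A - B)"
proof (rule gmatI)
  have cA: "A \<in> carrier_mat (length rs) (length cs)" and cB: "B \<in> carrier_mat (length rs) (length cs)"
    using A B by auto
  then show "A - B \<in> carrier_mat (length rs) (length cs)" by (auto simp: minus_carrier_mat)
  fix b c assume bc: "b < length rs" "c < length cs"
  have entry: "(A - B) $$ (b, c) = A $$ (b, c) - B $$ (b, c)" using cA cB bc by simp
  show "(A - B) $$ (b, c) \<in> poly_carrier n"
    unfolding entry by (intro poly_carrier_minus gmat_entry[OF A bc] gmat_entry[OF B bc])
  fix u assume "u \<in> Poly_Mapping.keys ((A - B) $$ (b, c))"
  then have "u \<in> Poly_Mapping.keys (A $$ (b, c)) \<or> u \<in> Poly_Mapping.keys (B $$ (b, c))"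
    unfolding entry by (auto simp: in_keys_iff lookup_minus)
  then show "mdeg u + rs ! b = cs ! c"
    using gmat_entry(2)[OF A bc] gmat_entry(2)[OF B bc] by blast
qed

lemma gmat_one: "gmat n rs rs (1\<^sub>m (length rs))"
  by (rule gmatI) (auto split: if_splits)

lemma gmat_shift:
  assumes "gmat n rs cs A"
  shows "gmat n (map (\<lambda>x. x + s) rs) (map (\<lambda>x. x + s) cs) A"
  using assms by (auto simp: gmat_def simp flip: add.assoc)

text \<open>Exactness supplies preimages of the columns that need not be homogeneous. As
  \<open>A\<close> preserves degrees and each column of \<open>Y\<close> is homogeneous, the
  component of the right degree of a preimage is again a preimage.\<close>

lemma gmat_lift:
  assumes A: "gmat n rs ms A" and Y: "gmat n rs cs Y"
    and ex: "\<And>c. c < length cs \<Longrightarrow> \<exists>v\<in>free_module n (length ms). A *\<^sub>v v = col Y c"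
  shows "\<exists>X. gmat n ms cs X \<and> A * X = Y"
proof -
  have cA: "A \<in> carrier_mat (length rs) (length ms)" and cY: "Y \<in> carrier_mat (length rs) (length cs)"
    using A Y by auto
  from ex obtain v where v: "\<And>c. c < length cs \<Longrightarrow> v c \<in> free_module n (length ms)"
    and Av: "\<And>c. c < length cs \<Longrightarrow> A *\<^sub>v v c = col Y c"
    by metis
  define X where "X = Matrix.mat (length ms) (length cs) (\<lambda>(j, c). hpart (cs ! c) (ms ! j) (v c $ j))"
  have cX: "X \<in> carrier_mat (length ms) (length cs)" by (simp add: X_def)
  have X: "gmat n ms cs X"
  proof (rule gmatI[OF cX])
    fix j c assume jc: "j < length ms" "c < length cs"
    show "X $$ (j, c) \<in> poly_carrier n"
      using v[OF jc(2)] jc by (auto simp: X_def keys_hpart poly_carrier_iff free_module_def)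
    show "mdeg u + ms ! j = cs ! c" if "u \<in> Poly_Mapping.keys (X $$ (j, c))" for u
      using that jc by (simp add: X_def keys_hpart)
  qed
  have "A * X = Y"
  proof (rule eq_matI)
    fix b c assume "b < dim_row Y" "c < dim_col Y"
    with cY have bc: "b < length rs" "c < length cs" by auto
    have dv: "dim_vec (v c) = length ms" using v[OF bc(2)] by (auto simp: free_module_def)
    have "Y $$ (b, c) = (A *\<^sub>v v c) $ b" using Av[OF bc(2)] cY bc by simp
    also have "\<dots> = (\<Sum>j<length ms. A $$ (b, j) * v c $ j)"
      using cA bc dv by (auto simp: scalar_prod_def lessThan_atLeast0)
    finally have Ybc: "Y $$ (b, c) = (\<Sum>j<length ms. A $$ (b, j) * v c $ j)" .
    have "(A * X) $$ (b, c) = (\<Sum>j<length ms. A $$ (b, j) * X $$ (j, c))"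
      using cA cX bc by (auto simp: scalar_prod_def lessThan_atLeast0)
    also have "\<dots> = (\<Sum>j<length ms. hpart (cs ! c) (rs ! b) (A $$ (b, j) * v c $ j))"
    proof (rule sum.cong[OF refl])
      fix j assume "j \<in> {..<length ms}"
      then have j: "j < length ms" by simp
      then have "hpart (cs ! c) (rs ! b) (A $$ (b, j) * v c $ j) = A $$ (b, j) * hpart (cs ! c) (ms ! j) (v c $ j)"
        by (intro hpart_mult gmat_entry(2)[OF A bc(1)])
      then show "A $$ (b, j) * X $$ (j, c) = hpart (cs ! c) (rs ! b) (A $$ (b, j) * v c $ j)"
        using j bc by (simp add: X_def)
    qed
    also have "\<dots> = hpart (cs ! c) (rs ! b) (Y $$ (b, c))" by (simp add: Ybc hpart_sum)
    also have "\<dots> = Y $$ (b, c)" by (rule hpart_ident) (rule gmat_entry(2)[OF Y bc])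
    finally show "(A * X) $$ (b, c) = Y $$ (b, c)" .
  qed (use cA cX cY in auto)
  with X show ?thesis by blast
qed

section \<open>Comparison of graded free resolutions\<close>

lemma mult_mat_unit_vec:
  fixes A :: "'a::semiring_1 mat"
  assumes "A \<in> carrier_mat r m" "c < m"
  shows "A *\<^sub>v unit_vec m c = col A c"
  using assms by (intro eq_vecI) auto

lemma free_module_unit: "c < r \<Longrightarrow> unit_vec r c \<in> free_module n r"
  by (simp add: free_module_def unit_vec_def)

lemma gmat_col: "gmat n rs cs Y \<Longrightarrow> c < length cs \<Longrightarrow> col Y c \<in> free_module n (length rs)"
  by (auto simp: free_module_def gmat_def)

lemma gmat_mult_vec:
  assumes A: "gmat n rs cs A" and v: "v \<in> free_module n (length cs)"
  shows "A *\<^sub>v v \<in> free_module n (length rs)"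
proof -
  have "(A *\<^sub>v v) $ b \<in> poly_carrier n" if "b < length rs" for b
  proof -
    have "(A *\<^sub>v v) $ b = (\<Sum>j<length cs. A $$ (b, j) * v $ j)"
      using gmat_carrier[OF A] v that by (auto simp: scalar_prod_def lessThan_atLeast0 free_module_def)
    also have "\<dots> \<in> poly_carrier n"
      using v that by (auto intro!: poly_carrier_sum poly_carrier_mult gmat_entry[OF A] simp: free_module_def)
    finally show ?thesis .
  qed
  then show ?thesis
    using mult_mat_vec_carrier[OF gmat_carrier[OF A]] v by (simp add: free_module_def)
qed

lemma resolution_gmat:
  "graded_free_resolution n I a A \<Longrightarrow> gmat n (target_shifts a i) (a i) (A i)"
  unfolding graded_free_resolution_def gmat_def by blast

lemma resolution_image:
  "graded_free_resolution n I a A \<Longrightarrow> (\<lambda>v. (A 0 *\<^sub>v v) $ 0) ` free_module n (length (a 0)) = I"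
  unfolding graded_free_resolution_def by blast

lemma resolution_exact:
  "graded_free_resolution n I a A \<Longrightarrow>
    (\<lambda>v. A (Suc i) *\<^sub>v v) ` free_module n (length (a (Suc i))) =
      {v \<in> free_module n (length (a i)). A i *\<^sub>v v = 0\<^sub>v (length (target_shifts a i))}"
  unfolding graded_free_resolution_def by blast

lemma target_shifts_simps [simp]: "target_shifts a 0 = [0]" "target_shifts a (Suc i) = a i"
  by (simp_all add: target_shifts_def)

lemma resolution_carrier:
  assumes "graded_free_resolution n I a A"
  shows "A 0 \<in> carrier_mat 1 (length (a 0))" "A (Suc i) \<in> carrier_mat (length (a i)) (length (a (Suc i)))"
  using gmat_carrier[OF resolution_gmat[OF assms, of 0]] gmat_carrier[OF resolution_gmat[OF assms, of "Suc i"]] by simp_all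

text \<open>The columns of \<open>A (Suc i)\<close> are images of unit vectors, so exactness puts
  them into the kernel of \<open>A i\<close>.\<close>

lemma resolution_complex:
  assumes res: "graded_free_resolution n I a A"
  shows "A i * A (Suc i) = 0\<^sub>m (length (target_shifts a i)) (length (a (Suc i)))"
proof (rule eq_matI)
  have cA: "A i \<in> carrier_mat (length (target_shifts a i)) (length (a i))"
    and cA': "A (Suc i) \<in> carrier_mat (length (a i)) (length (a (Suc i)))"
    using gmat_carrier[OF resolution_gmat[OF res, of i]] gmat_carrier[OF resolution_gmat[OF res, of "Suc i"]] by simp_all
  then show "dim_row (A i * A (Suc i)) = dim_row (0\<^sub>m (length (target_shifts a i)) (length (a (Suc i))))"
    "dim_col (A i * A (Suc i)) = dim_col (0\<^sub>m (length (target_shifts a i)) (length (a (Suc i))))" by auto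
  fix b c
  assume "b < dim_row (0\<^sub>m (length (target_shifts a i)) (length (a (Suc i))))"
    "c < dim_col (0\<^sub>m (length (target_shifts a i)) (length (a (Suc i))))"
  then have bc: "b < length (target_shifts a i)" "c < length (a (Suc i))" by auto
  have "A (Suc i) *\<^sub>v unit_vec (length (a (Suc i))) c = col (A (Suc i)) c"
    by (rule mult_mat_unit_vec[OF cA' bc(2)])
  moreover have "A (Suc i) *\<^sub>v unit_vec (length (a (Suc i))) c \<in>
      (\<lambda>v. A (Suc i) *\<^sub>v v) ` free_module n (length (a (Suc i)))"
    using free_module_unit[OF bc(2)] by (rule imageI)
  ultimately have "A i *\<^sub>v col (A (Suc i)) c = 0\<^sub>v (length (target_shifts a i))"
    unfolding resolution_exact[OF res] by simp
  then have "(A i *\<^sub>v col (A (Suc i)) c) $ b = 0" using bc by simp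
  then show "(A i * A (Suc i)) $$ (b, c) = 0\<^sub>m (length (target_shifts a i)) (length (a (Suc i))) $$ (b, c)"
    using cA cA' bc by simp
qed

lemma resolution_lift:
  assumes res: "graded_free_resolution n I a A" and Y: "gmat n (a i) cs Y"
    and zero: "A i * Y = 0\<^sub>m (length (target_shifts a i)) (length cs)"
  shows "\<exists>X. gmat n (a (Suc i)) cs X \<and> A (Suc i) * X = Y"
proof (rule gmat_lift[OF _ Y])
  show "gmat n (a i) (a (Suc i)) (A (Suc i))" using resolution_gmat[OF res, of "Suc i"] by simp
  fix c assume c: "c < length cs"
  have cA: "A i \<in> carrier_mat (length (target_shifts a i)) (length (a i))"
    using gmat_carrier[OF resolution_gmat[OF res, of i]] .
  have "A i *\<^sub>v col Y c = col (A i * Y) c"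
    using col_mult2[OF cA gmat_carrier[OF Y] c] by simp
  also have "\<dots> = 0\<^sub>v (length (target_shifts a i))" using c by (simp add: zero)
  finally have "col Y c \<in> {v \<in> free_module n (length (a i)). A i *\<^sub>v v = 0\<^sub>v (length (target_shifts a i))}"
    using gmat_col[OF Y c] by simp
  then show "\<exists>v\<in>free_module n (length (a (Suc i))). A (Suc i) *\<^sub>v v = col Y c"
    unfolding resolution_exact[OF res, of i, symmetric] by auto
qed

text \<open>The start of a lift: at the augmentation, exactness is replaced by the statement that
  the image is \<open>I\<close>.\<close>

lemma resolution_lift_augmentation:
  assumes res: "graded_free_resolution n I a A" and Y: "gmat n [0] cs Y"
    and mem: "\<And>c. c < length cs \<Longrightarrow> Y $$ (0, c) \<in> I"
  shows "\<exists>X. gmat n (a 0) cs X \<and> A 0 * X = Y"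
proof (rule gmat_lift[OF _ Y])
  show "gmat n [0] (a 0) (A 0)" using resolution_gmat[OF res, of 0] by simp
  fix c assume c: "c < length cs"
  obtain v where v: "v \<in> free_module n (length (a 0))" "(A 0 *\<^sub>v v) $ 0 = Y $$ (0, c)"
    using mem[OF c] unfolding resolution_image[OF res, symmetric] by auto
  have "A 0 *\<^sub>v v = col Y c"
    using v(2) c resolution_carrier(1)[OF res] gmat_carrier[OF Y] by (intro eq_vecI) auto
  then show "\<exists>v\<in>free_module n (length (a 0)). A 0 *\<^sub>v v = col Y c" using v(1) by blast
qed

lemma resolution_entry_mem:
  assumes res: "graded_free_resolution n I a A" and c: "c < length (a 0)"
  shows "A 0 $$ (0, c) \<in> I"
proof -
  have "(A 0 *\<^sub>v unit_vec (length (a 0)) c) $ 0 = A 0 $$ (0, c)"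
    using resolution_carrier(1)[OF res] mult_mat_unit_vec[OF resolution_carrier(1)[OF res] c] c by simp
  then show ?thesis
    using free_module_unit[OF c, of n] unfolding resolution_image[OF res, symmetric] by force
qed

text \<open>The comparison theorem: \<open>A\<close> need only be a complex of free modules, while
  \<open>B\<close> is exact. The twist \<open>s\<close> is 0 when two resolutions of one ideal are
  compared, and the degree of \<open>f\<close> when multiplication by \<open>f\<close> is lifted for
  a mapping cone.\<close>

lemma resolution_comparison:
  assumes res: "graded_free_resolution n J b B"
    and A: "\<And>i. gmat n (a i) (a (Suc i)) (A (Suc i))"
    and AA: "\<And>i. A (Suc i) * A (Suc (Suc i)) = 0\<^sub>m (length (a i)) (length (a (Suc (Suc i))))"
    and Y: "gmat n [0] (map (\<lambda>x. x + s) (a 0)) Y"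
    and mem: "\<And>c. c < length (a 0) \<Longrightarrow> Y $$ (0, c) \<in> J"
    and YA: "Y * A 1 = 0\<^sub>m 1 (length (a 1))"
  obtains \<Phi> where "\<And>i. gmat n (b i) (map (\<lambda>x. x + s) (a i)) (\<Phi> i)"
    and "B 0 * \<Phi> 0 = Y" and "\<And>i. B (Suc i) * \<Phi> (Suc i) = \<Phi> i * A (Suc i)"
proof -
  \<comment> \<open>\<open>P\<close> records that the next map to be lifted consists of cycles,
    \<open>Q\<close> that the new square commutes; dependent choice then assembles the chain
    map.\<close>
  define P where "P i X \<longleftrightarrow> gmat n (b i) (map (\<lambda>x. x + s) (a i)) X \<and>
      B i * X * A (Suc i) = 0\<^sub>m (length (target_shifts b i)) (length (a (Suc i))) \<and> (i = 0 \<longrightarrow> B 0 * X = Y)" for i X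
  define Q where "Q i X X' \<longleftrightarrow> B (Suc i) * X' = X * A (Suc i)" for i X X'
  have "\<exists>X. P 0 X"
    using resolution_lift_augmentation[OF res Y] mem YA by (auto simp: P_def)
  moreover have "\<exists>X'. P (Suc i) X' \<and> Q i X X'" if "P i X" for i X
  proof -
    have gX: "gmat n (b i) (map (\<lambda>x. x + s) (a i)) X" using that by (simp add: P_def)
    have gY: "gmat n (b i) (map (\<lambda>x. x + s) (a (Suc i))) (X * A (Suc i))"
      using gmat_mult[OF gX gmat_shift[OF A]] .
    have cX: "X \<in> carrier_mat (length (b i)) (length (a i))" using gmat_carrier[OF gX] by simp
    have cB: "B i \<in> carrier_mat (length (target_shifts b i)) (length (b i))"
      using gmat_carrier[OF resolution_gmat[OF res, of i]] .
    have "B i * (X * A (Suc i)) = 0\<^sub>m (length (target_shifts b i)) (length (map (\<lambda>x. x + s) (a (Suc i))))"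
      using that assoc_mult_mat[OF cB cX gmat_carrier[OF A]] by (simp add: P_def)
    then obtain X' where X': "gmat n (b (Suc i)) (map (\<lambda>x. x + s) (a (Suc i))) X'" "B (Suc i) * X' = X * A (Suc i)"
      using resolution_lift[OF res gY] by blast
    have "X * A (Suc i) * A (Suc (Suc i)) = X * (A (Suc i) * A (Suc (Suc i)))"
      using assoc_mult_mat[OF cX gmat_carrier[OF A] gmat_carrier[OF A]] .
    also have "\<dots> = 0\<^sub>m (length (b i)) (length (a (Suc (Suc i))))"
      using cX by (simp add: AA)
    finally have "P (Suc i) X'" using X' by (simp add: P_def)
    then show ?thesis using X'(2) by (auto simp: Q_def)
  qed
  ultimately obtain \<Phi> where "\<And>i. P i (\<Phi> i)" "\<And>i. Q i (\<Phi> i) (\<Phi> (Suc i))"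
    using dependent_nat_choice[of P Q] by metis
  then show ?thesis using that[of \<Phi>] by (simp add: P_def Q_def)
qed

text \<open>A chain endomorphism that lifts the zero map of \<open>I\<close> is
  null-homotopic.\<close>

lemma resolution_homotopy:
  assumes res: "graded_free_resolution n I a A"
    and \<Theta>: "\<And>i. gmat n (a i) (a i) (\<Theta> i)"
    and \<Theta>0: "A 0 * \<Theta> 0 = 0\<^sub>m 1 (length (a 0))"
    and comm: "\<And>i. A (Suc i) * \<Theta> (Suc i) = \<Theta> i * A (Suc i)"
  obtains H where "\<And>i. gmat n (a (Suc i)) (a i) (H i)"
    and "A 1 * H 0 = \<Theta> 0" and "\<And>i. A (Suc (Suc i)) * H (Suc i) = \<Theta> (Suc i) - H i * A (Suc i)"
proof -
  \<comment> \<open>Together with \<open>comm\<close>, the equation in \<open>P\<close> says that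
    \<open>\<Theta> (Suc i) - H * A (Suc i)\<close> is killed by \<open>A (Suc i)\<close>, which is
    what lifting the next homotopy map requires.\<close>
  define P where "P i H \<longleftrightarrow> gmat n (a (Suc i)) (a i) H \<and>
      A (Suc i) * (H * A (Suc i)) = \<Theta> i * A (Suc i) \<and> (i = 0 \<longrightarrow> A 1 * H = \<Theta> 0)" for i H
  define Q where "Q i H H' \<longleftrightarrow> A (Suc (Suc i)) * H' = \<Theta> (Suc i) - H * A (Suc i)" for i H H'
  have gA: "gmat n (a i) (a (Suc i)) (A (Suc i))" for i
    using resolution_gmat[OF res, of "Suc i"] by simp
  note cA = gmat_carrier[OF gA] and c\<Theta> = gmat_carrier[OF \<Theta>]
  have "\<exists>H. P 0 H"
  proof -
    obtain H where H: "gmat n (a (Suc 0)) (a 0) H" "A (Suc 0) * H = \<Theta> 0"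
      using resolution_lift[OF res \<Theta>, of 0] \<Theta>0 by auto
    then show ?thesis using assoc_mult_mat[OF cA gmat_carrier[OF H(1)] cA] by (auto simp: P_def)
  qed
  moreover have "\<exists>H'. P (Suc i) H' \<and> Q i H H'" if "P i H" for i H
  proof -
    have gH: "gmat n (a (Suc i)) (a i) H" using that by (simp add: P_def)
    note cH = gmat_carrier[OF gH]
    have gY: "gmat n (a (Suc i)) (a (Suc i)) (\<Theta> (Suc i) - H * A (Suc i))"
      by (intro gmat_minus \<Theta> gmat_mult[OF gH gA])
    have "A (Suc i) * (\<Theta> (Suc i) - H * A (Suc i)) = A (Suc i) * \<Theta> (Suc i) - A (Suc i) * (H * A (Suc i))"
      using cH cA by (intro mult_minus_distrib_mat[OF cA c\<Theta>]) auto
    also have "\<dots> = 0\<^sub>m (length (target_shifts a (Suc i))) (length (a (Suc i)))"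
      using that c\<Theta>[of i] cA[of i] by (auto simp: P_def comm)
    finally obtain H' where H': "gmat n (a (Suc (Suc i))) (a (Suc i)) H'"
        "A (Suc (Suc i)) * H' = \<Theta> (Suc i) - H * A (Suc i)"
      using resolution_lift[OF res gY] by blast
    note cH' = gmat_carrier[OF H'(1)]
    have "A (Suc (Suc i)) * (H' * A (Suc (Suc i))) = (\<Theta> (Suc i) - H * A (Suc i)) * A (Suc (Suc i))"
      using assoc_mult_mat[OF cA cH' cA] H'(2) by simp
    also have "\<dots> = \<Theta> (Suc i) * A (Suc (Suc i)) - H * A (Suc i) * A (Suc (Suc i))"
      using cH cA by (intro minus_mult_distrib_mat[OF c\<Theta> _ cA]) auto
    also have "H * A (Suc i) * A (Suc (Suc i)) = H * (A (Suc i) * A (Suc (Suc i)))"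
      by (rule assoc_mult_mat[OF cH cA cA])
    also have "\<dots> = 0\<^sub>m (length (a (Suc i))) (length (a (Suc (Suc i))))"
      using cH resolution_complex[OF res, of "Suc i"] by simp
    finally have "P (Suc i) H'" using H'(1) c\<Theta>[of "Suc i"] cA[of "Suc i"] by (auto simp: P_def)
    then show ?thesis using H'(2) by (auto simp: Q_def)
  qed
  ultimately obtain H where "\<And>i. P i (H i)" "\<And>i. Q i (H i) (H (Suc i))"
    using dependent_nat_choice[of P Q] by metis
  then show ?thesis using that[of H] by (simp add: P_def Q_def)
qed

section \<open>Reduction modulo the variables and vanishing of Tor\<close>

lemma lookup_mult_zero:
  "Poly_Mapping.lookup (p * q) (0 :: monomial) = Poly_Mapping.lookup p 0 * Poly_Mapping.lookup q (0 :: monomial)"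
  for p q :: "'k::field mpoly"
proof -
  \<comment> \<open>Exponents are natural numbers, so the trivial monomial factors only trivially
    and taking the constant coefficient is multiplicative.\<close>
  have "l + r = 0 \<longleftrightarrow> l = 0 \<and> r = 0" for l r :: monomial
    by (auto simp: poly_mapping_eq_iff fun_eq_iff lookup_add)
  then have "(Poly_Mapping.lookup q r when 0 = l + r) = ((Poly_Mapping.lookup q r when r = 0) when l = 0)" for l r
    by (auto simp: when_def eq_commute[of 0])
  then have "Poly_Mapping.lookup (p * q) 0 =
      (\<Sum>l. Poly_Mapping.lookup p l * (\<Sum>r. (Poly_Mapping.lookup q r when r = 0) when l = 0))"
    unfolding lookup_mult by presburger
  also have "\<dots> = (\<Sum>l. Poly_Mapping.lookup p l * Poly_Mapping.lookup q 0 when l = 0)"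
    by (rule Sum_any.cong) (simp add: when_def)
  finally show ?thesis by simp
qed

lemma residue_mat_mult:
  assumes "A \<in> carrier_mat r m" "B \<in> carrier_mat m c"
  shows "residue_mat (A * B) = residue_mat A * residue_mat B"
  using assms
  by (intro eq_matI) (auto simp: residue_mat_def scalar_prod_def lookup_sum lookup_mult_zero)

lemma residue_mat_minus:
  assumes "A \<in> carrier_mat r c" "B \<in> carrier_mat r c"
  shows "residue_mat (A - B) = residue_mat A - residue_mat B"
  using assms by (intro eq_matI) (auto simp: residue_mat_def lookup_minus)

lemma residue_mat_one [simp]: "residue_mat (1\<^sub>m r) = 1\<^sub>m r"
  by (intro eq_matI) (auto simp: residue_mat_def lookup_one)

lemma residue_mat_zero [simp]: "residue_mat (0\<^sub>m r c) = 0\<^sub>m r c"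
  by (intro eq_matI) (auto simp: residue_mat_def)

lemma residue_mat_carrier: "A \<in> carrier_mat r c \<Longrightarrow> residue_mat A \<in> carrier_mat r c"
  by (simp add: residue_mat_def)

text \<open>An entry with nonzero constant coefficient joins a row and a column of equal shift, so
  reduced maps respect the internal degree.\<close>

lemma residue_mult_fibre:
  assumes A: "gmat n (a i) (b j) A" and v: "v \<in> fibre_component b j e"
  shows "residue_mat A *\<^sub>v v \<in> fibre_component a i e"
proof -
  have cA: "residue_mat A \<in> carrier_mat (length (a i)) (length (b j))"
    using residue_mat_carrier[OF gmat_carrier[OF A]] .
  have "a i ! r = e" if r: "r < length (a i)" and nz: "(residue_mat A *\<^sub>v v) $ r \<noteq> 0" for r
  proof -
    have "(residue_mat A *\<^sub>v v) $ r = (\<Sum>c<length (b j). residue_mat A $$ (r, c) * v $ c)"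
      using cA r v by (auto simp: scalar_prod_def lessThan_atLeast0 fibre_component_def)
    with nz obtain c where c: "c < length (b j)" "residue_mat A $$ (r, c) \<noteq> 0" "v $ c \<noteq> 0"
      by (metis (no_types, lifting) lessThan_iff mult_eq_0_iff sum.neutral)
    then have "0 \<in> Poly_Mapping.keys (A $$ (r, c))"
      using r gmat_carrier[OF A] by (auto simp: residue_mat_def in_keys_iff)
    then have "a i ! r = b j ! c" using gmat_entry(2)[OF A r c(1)] by fastforce
    also have "\<dots> = e" using v c by (auto simp: fibre_component_def)
    finally show ?thesis .
  qed
  then show ?thesis using mult_mat_vec_carrier[OF cA] v by (auto simp: fibre_component_def)
qed

text \<open>Let \<Phi> and \<Psi> be comparison maps in the two directions. Then
  \<open>\<Psi> i * \<Phi> i - 1\<close> is null-homotopic, while on the degree \<open>e\<close>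
  fibre \<Phi> lands in the zero space because \<open>b i\<close> lacks \<open>e\<close>. So minus
  the identity is null-homotopic there and cycles coincide with boundaries; no dimension has to be
  computed.\<close>

lemma tor_dim_eq_0:
  assumes resa: "graded_free_resolution n I a A" and resb: "graded_free_resolution n I b B"
    and e: "e \<notin> set (b i)"
  shows "tor_dim a A i e = 0"
proof -
  have gA: "gmat n (a i) (a (Suc i)) (A (Suc i))" for i
    using resolution_gmat[OF resa, of "Suc i"] by simp
  have gB: "gmat n (b i) (b (Suc i)) (B (Suc i))" for i
    using resolution_gmat[OF resb, of "Suc i"] by simp
  have cA0: "A 0 \<in> carrier_mat 1 (length (a 0))" by (rule resolution_carrier[OF resa])
  obtain \<Phi> where \<Phi>: "\<And>i. gmat n (b i) (a i) (\<Phi> i)" "B 0 * \<Phi> 0 = A 0"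
      "\<And>i. B (Suc i) * \<Phi> (Suc i) = \<Phi> i * A (Suc i)"
  proof (rule resolution_comparison[OF resb, of a A 0 "A 0"])
    show "gmat n [0] (map (\<lambda>x. x + 0) (a 0)) (A 0)" using resolution_gmat[OF resa, of 0] by simp
    show "A 0 * A 1 = 0\<^sub>m 1 (length (a 1))" using resolution_complex[OF resa, of 0] by simp
    show "A (Suc i) * A (Suc (Suc i)) = 0\<^sub>m (length (a i)) (length (a (Suc (Suc i))))" for i
      using resolution_complex[OF resa, of "Suc i"] by simp
  qed (use gA resolution_entry_mem[OF resa] in auto)
  obtain \<Psi> where \<Psi>: "\<And>i. gmat n (a i) (b i) (\<Psi> i)" "A 0 * \<Psi> 0 = B 0"
      "\<And>i. A (Suc i) * \<Psi> (Suc i) = \<Psi> i * B (Suc i)"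
  proof (rule resolution_comparison[OF resa, of b B 0 "B 0"])
    show "gmat n [0] (map (\<lambda>x. x + 0) (b 0)) (B 0)" using resolution_gmat[OF resb, of 0] by simp
    show "B 0 * B 1 = 0\<^sub>m 1 (length (b 1))" using resolution_complex[OF resb, of 0] by simp
    show "B (Suc i) * B (Suc (Suc i)) = 0\<^sub>m (length (b i)) (length (b (Suc (Suc i))))" for i
      using resolution_complex[OF resb, of "Suc i"] by simp
  qed (use gB resolution_entry_mem[OF resb] in auto)
  define \<Theta> where "\<Theta> i = \<Psi> i * \<Phi> i - 1\<^sub>m (length (a i))" for i
  note cA = gmat_carrier[OF gA] and cB = gmat_carrier[OF gB]
    and c\<Phi> = gmat_carrier[OF \<Phi>(1)] and c\<Psi> = gmat_carrier[OF \<Psi>(1)]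
  have c\<Psi>\<Phi>: "\<Psi> i * \<Phi> i \<in> carrier_mat (length (a i)) (length (a i))" for i
    using c\<Psi>[of i] c\<Phi>[of i] by simp
  have g\<Theta>: "gmat n (a i) (a i) (\<Theta> i)" for i
    unfolding \<Theta>_def by (intro gmat_minus gmat_one gmat_mult[OF \<Psi>(1) \<Phi>(1)])
  obtain H where H: "\<And>i. gmat n (a (Suc i)) (a i) (H i)" "A 1 * H 0 = \<Theta> 0"
      "\<And>i. A (Suc (Suc i)) * H (Suc i) = \<Theta> (Suc i) - H i * A (Suc i)"
  proof (rule resolution_homotopy[OF resa g\<Theta>])
    have "A 0 * \<Theta> 0 = A 0 * (\<Psi> 0 * \<Phi> 0) - A 0"
      unfolding \<Theta>_def using mult_minus_distrib_mat[OF cA0 c\<Psi>\<Phi> one_carrier_mat] cA0 by simp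
    also have "A 0 * (\<Psi> 0 * \<Phi> 0) = A 0"
      using assoc_mult_mat[OF cA0 c\<Psi> c\<Phi>] by (simp add: \<Psi> \<Phi>)
    finally show "A 0 * \<Theta> 0 = 0\<^sub>m 1 (length (a 0))" using cA0 by simp
    show "A (Suc i) * \<Theta> (Suc i) = \<Theta> i * A (Suc i)" for i
    proof -
      have "A (Suc i) * (\<Psi> (Suc i) * \<Phi> (Suc i)) = \<Psi> i * B (Suc i) * \<Phi> (Suc i)"
        using assoc_mult_mat[OF cA c\<Psi> c\<Phi>, of i] by (simp add: \<Psi>)
      also have "\<dots> = \<Psi> i * (\<Phi> i * A (Suc i))"
        using assoc_mult_mat[OF c\<Psi> cB c\<Phi>, of i] by (simp add: \<Phi>)
      also have "\<dots> = \<Psi> i * \<Phi> i * A (Suc i)"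
        using assoc_mult_mat[OF c\<Psi> c\<Phi> cA, of i] by simp
      finally show ?thesis
        unfolding \<Theta>_def
        using mult_minus_distrib_mat[OF cA c\<Psi>\<Phi> one_carrier_mat] cA[of i]
          minus_mult_distrib_mat[OF c\<Psi>\<Phi> one_carrier_mat cA, of i] by simp
    qed
  qed (use that in auto)
  let ?d = "length (a i)"
  have "v \<in> tor_boundaries a A i e" if v: "v \<in> tor_cycles a A i e" for v
  proof -
    have vf: "v \<in> fibre_component a i e" and vc: "v \<in> carrier_vec ?d"
      using v by (auto simp: tor_cycles_def fibre_component_def)
    have "residue_mat (\<Phi> i) *\<^sub>v v \<in> fibre_component b i e"
      using residue_mult_fibre[of n b i a i, OF \<Phi>(1) vf] .
    \<comment> \<open>A vector of \<open>fibre_component b i e\<close> may be nonzero only at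
      positions whose shift is \<open>e\<close>, and there are none.\<close>
    then have "residue_mat (\<Phi> i) *\<^sub>v v = 0\<^sub>v (length (b i))"
      using e residue_mat_carrier[OF c\<Phi>[of i]]
      by (intro eq_vecI) (auto simp: fibre_component_def in_set_conv_nth)
    then have "residue_mat (\<Psi> i * \<Phi> i) *\<^sub>v v = 0\<^sub>v ?d"
      using residue_mat_mult[OF c\<Psi> c\<Phi>, of i]
        assoc_mult_mat_vec[OF residue_mat_carrier[OF c\<Psi>] residue_mat_carrier[OF c\<Phi>] vc]
        residue_mat_carrier[OF c\<Psi>[of i]]
      by (auto intro!: eq_vecI)
    then have \<Theta>v: "residue_mat (\<Theta> i) *\<^sub>v v = - v"
      unfolding \<Theta>_def using residue_mat_minus[OF c\<Psi>\<Phi> one_carrier_mat, of i]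
        minus_mult_distrib_mat_vec[OF residue_mat_carrier[OF c\<Psi>\<Phi>] one_carrier_mat vc] vc by simp
    \<comment> \<open>The homotopy term \<open>H j * A i\<close> exists only for
      \<open>i = Suc j\<close>, and there it dies because \<open>v\<close> is a cycle. In degree 0
      both the term and the cycle condition are absent.\<close>
    have "residue_mat (A (Suc i) * H i) *\<^sub>v v = residue_mat (\<Theta> i) *\<^sub>v v"
    proof (cases i)
      case 0
      then show ?thesis using H(2) by simp
    next
      case (Suc j)
      have cHA: "H j * A i \<in> carrier_mat ?d ?d" using gmat_carrier[OF H(1)[of j]] cA[of j] Suc by auto
      have "residue_mat (H j * A i) *\<^sub>v v = residue_mat (H j) *\<^sub>v (residue_mat (A i) *\<^sub>v v)"
        using residue_mat_mult[OF gmat_carrier[OF H(1)] cA, of j]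
          assoc_mult_mat_vec[OF residue_mat_carrier[OF gmat_carrier[OF H(1)]] residue_mat_carrier[OF cA], of v j] vc Suc
        by simp
      also have "residue_mat (A i) *\<^sub>v v = 0\<^sub>v (length (a j))"
        using v Suc by (simp add: tor_cycles_def)
      also have "residue_mat (H j) *\<^sub>v 0\<^sub>v (length (a j)) = 0\<^sub>v ?d"
        using residue_mat_carrier[OF gmat_carrier[OF H(1)[of j]]] Suc by (auto intro!: eq_vecI)
      finally have HA: "residue_mat (H j * A i) *\<^sub>v v = 0\<^sub>v ?d" .
      have "residue_mat (A (Suc i) * H i) = residue_mat (\<Theta> i) - residue_mat (H j * A i)"
        using residue_mat_minus[OF gmat_carrier[OF g\<Theta>] cHA] H(3)[of j] Suc by simp
      then show ?thesis
        using minus_mult_distrib_mat_vec[OF residue_mat_carrier[OF gmat_carrier[OF g\<Theta>]] residue_mat_carrier[OF cHA] vc]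
          HA residue_mat_carrier[OF gmat_carrier[OF g\<Theta>[of i]]] vc by simp
    qed
    then have AHv: "residue_mat (A (Suc i)) *\<^sub>v (residue_mat (H i) *\<^sub>v v) = - v"
      using residue_mat_mult[OF cA gmat_carrier[OF H(1)], of i] \<Theta>v
        assoc_mult_mat_vec[OF residue_mat_carrier[OF cA] residue_mat_carrier[OF gmat_carrier[OF H(1)]] vc] by simp
    have "- v \<in> fibre_component a i e" using vf by (auto simp: fibre_component_def)
    \<comment> \<open>\<open>\<Theta> i\<close> acts on \<open>v\<close> as -1, hence the sign: it
      is the negative of the homotopy that carries \<open>v\<close> to a preimage under
      \<open>A (Suc i)\<close>.\<close>
    have fib: "residue_mat (- H i) *\<^sub>v v \<in> fibre_component a (Suc i) e"
      using residue_mult_fibre[of n a "Suc i" a i, OF gmat_uminus[OF H(1)] vf] .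
    have "residue_mat (- H i) *\<^sub>v v = - (residue_mat (H i) *\<^sub>v v)"
      using gmat_carrier[OF H(1)[of i]] vc
      by (auto intro!: eq_vecI simp: residue_mat_def scalar_prod_def sum_negf)
    moreover have "residue_mat (A (Suc i)) *\<^sub>v - (residue_mat (H i) *\<^sub>v v) = v"
    proof -
      have "residue_mat (A (Suc i)) *\<^sub>v - (residue_mat (H i) *\<^sub>v v) = - (residue_mat (A (Suc i)) *\<^sub>v (residue_mat (H i) *\<^sub>v v))"
        using residue_mat_carrier[OF cA[of i]] residue_mat_carrier[OF gmat_carrier[OF H(1)[of i]]] vc
        by (auto intro!: eq_vecI simp: scalar_prod_def sum_negf)
      then show ?thesis using AHv by simp
    qed
    ultimately show ?thesis unfolding tor_boundaries_def using fib by (metis image_eqI)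
  qed
  moreover have "v \<in> tor_cycles a A i e" if v: "v \<in> tor_boundaries a A i e" for v
  proof -
    obtain w where w: "w \<in> fibre_component a (Suc i) e" "v = residue_mat (A (Suc i)) *\<^sub>v w"
      using v by (auto simp: tor_boundaries_def)
    have wc: "w \<in> carrier_vec (length (a (Suc i)))" using w by (simp add: fibre_component_def)
    have cAi: "A i \<in> carrier_mat (length (target_shifts a i)) ?d"
      using gmat_carrier[OF resolution_gmat[OF resa]] .
    have "residue_mat (A i) *\<^sub>v v = residue_mat (A i * A (Suc i)) *\<^sub>v w"
      unfolding w(2) residue_mat_mult[OF cAi cA]
      using assoc_mult_mat_vec[OF residue_mat_carrier[OF cAi] residue_mat_carrier[OF cA] wc] by simp
    also have "\<dots> = 0\<^sub>v (length (target_shifts a i))"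
      using wc by (auto simp: resolution_complex[OF resa] intro!: eq_vecI)
    finally show ?thesis
      using residue_mult_fibre[of n a i a "Suc i", OF gA w(1)] w(2) by (simp add: tor_cycles_def)
  qed
  ultimately have "tor_cycles a A i e = tor_boundaries a A i e" by blast
  then show ?thesis by (simp add: tor_dim_def)
qed

section \<open>Mapping cones\<close>

lemma free_module_carrier: "v \<in> free_module n r \<Longrightarrow> v \<in> carrier_vec r"
  by (simp add: free_module_def)

lemma free_module_append:
  "v \<in> free_module n r \<Longrightarrow> w \<in> free_module n s \<Longrightarrow> v @\<^sub>v w \<in> free_module n (r + s)"
  by (auto simp: free_module_def)

lemma free_module_appendE:
  assumes "z \<in> free_module n (r + s)"
  obtains v w where "v \<in> free_module n r" "w \<in> free_module n s" "z = v @\<^sub>v w"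
proof
  have z: "z \<in> carrier_vec (r + s)" using assms by (rule free_module_carrier)
  show "vec_first z r \<in> free_module n r" using assms by (auto simp: free_module_def vec_first_def)
  show "vec_last z s \<in> free_module n s" using assms by (auto simp: free_module_def vec_last_def)
  show "z = vec_first z r @\<^sub>v vec_last z s" using vec_first_last_append[OF z] by simp
qed

lemma free_module_uminus: "v \<in> free_module n r \<Longrightarrow> - v \<in> free_module n r"
  using poly_carrier_uminus by (fastforce simp: free_module_def)

lemma free_module_minus: "v \<in> free_module n r \<Longrightarrow> w \<in> free_module n r \<Longrightarrow> v - w \<in> free_module n r"
  using poly_carrier_minus by (fastforce simp: free_module_def)

lemma gmat_four_block:
  assumes "gmat n rs cs A" "gmat n rs cs' B" "gmat n rs' cs C" "gmat n rs' cs' D"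
  shows "gmat n (rs @ rs') (cs @ cs') (four_block_mat A B C D)"
  using assms by (auto simp: gmat_def nth_append)

lemma gmat_zero: "gmat n rs cs (0\<^sub>m (length rs) (length cs))"
  by (simp add: gmat_def)

lemma uminus_mult_mat_vec:
  fixes A :: "'a::ring mat"
  assumes "A \<in> carrier_mat r m" "v \<in> carrier_vec m"
  shows "- A *\<^sub>v v = - (A *\<^sub>v v)" "A *\<^sub>v - v = - (A *\<^sub>v v)"
  using assms by (auto intro!: eq_vecI simp: scalar_prod_def sum_negf)

lemma vec_minus_add_cancel:
  fixes v :: "'a::group_add vec"
  assumes "v \<in> carrier_vec r" "w \<in> carrier_vec r"
  shows "v - w + w = v"
  using assms by (intro eq_vecI) auto

text \<open>The cone has F_i plus G_(i-1)(-s) in homological degree \<open>i\<close>.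
  \<open>target_shifts\<close> performs the index shift and also supplies G_(-1) = S, which for
  \<open>i = 0\<close> becomes the new generator of degree \<open>s\<close>.\<close>

definition cone_shifts :: "nat \<Rightarrow> (nat \<Rightarrow> nat list) \<Rightarrow> (nat \<Rightarrow> nat list) \<Rightarrow> nat \<Rightarrow> nat list"
  where "cone_shifts s a b i = a i @ map (\<lambda>x. x + s) (target_shifts b i)"

text \<open>For \<open>J = (I : f)\<close>, the mapping cone of a lift of \<open>f : S/J(-s) \<rightarrow> S/I\<close> to resolutions.\<close>

lemma mapping_cone:
  assumes resa: "graded_free_resolution n I a A" and resb: "graded_free_resolution n J b B"
    and f: "f \<in> poly_carrier n" "\<And>m. m \<in> Poly_Mapping.keys f \<Longrightarrow> mdeg m = s"
    and J: "J = {p \<in> poly_carrier n. f * p \<in> I}"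
  shows "\<exists>C. graded_free_resolution n {p + f * q |p q. p \<in> I \<and> q \<in> poly_carrier n} (cone_shifts s a b) C"
proof -
  have gA: "gmat n (target_shifts a i) (a i) (A i)" and gB: "gmat n (target_shifts b i) (b i) (B i)" for i
    by (rule resolution_gmat[OF resa], rule resolution_gmat[OF resb])
  have cB0: "B 0 \<in> carrier_mat 1 (length (b 0))" by (rule resolution_carrier[OF resb])
  have gF: "gmat n [0] [s] (Matrix.mat 1 1 (\<lambda>_. f))"
    using f by (auto simp: gmat_def)
  have gFB: "gmat n [0] (map (\<lambda>x. x + s) (b 0)) (Matrix.mat 1 1 (\<lambda>_. f) * B 0)"
    using gmat_mult[OF gF, of "map (\<lambda>x. x + s) (b 0)" "B 0"] gmat_shift[OF gB[of 0], of s] by simp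
  obtain \<Phi> where \<Phi>: "\<And>i. gmat n (a i) (map (\<lambda>x. x + s) (b i)) (\<Phi> i)"
      "A 0 * \<Phi> 0 = Matrix.mat 1 1 (\<lambda>_. f) * B 0"
      "\<And>i. A (Suc i) * \<Phi> (Suc i) = \<Phi> i * B (Suc i)"
  proof (rule resolution_comparison[where b = a and a = b and A = B, OF resa _ _ gFB])
    show "gmat n (b i) (b (Suc i)) (B (Suc i))" for i using gB[of "Suc i"] by simp
    show "B (Suc i) * B (Suc (Suc i)) = 0\<^sub>m (length (b i)) (length (b (Suc (Suc i))))" for i
      using resolution_complex[OF resb, of "Suc i"] by simp
    \<comment> \<open>Only the inclusion of \<open>J\<close> in the colon ideal enters here; the
      converse inclusion is used for exactness of the cone in degree 0.\<close>
    show "(Matrix.mat 1 1 (\<lambda>_. f) * B 0) $$ (0, c) \<in> I" if "c < length (b 0)" for c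
      using resolution_entry_mem[OF resb that] cB0 that by (auto simp: scalar_prod_def J)
    have "Matrix.mat 1 1 (\<lambda>_. f) * B 0 * B 1 = Matrix.mat 1 1 (\<lambda>_. f) * (B 0 * B 1)"
      using assoc_mult_mat[OF gmat_carrier[OF gF] _ resolution_carrier(2)[OF resb, of 0]] cB0 by simp
    then show "Matrix.mat 1 1 (\<lambda>_. f) * B 0 * B 1 = 0\<^sub>m 1 (length (b 1))"
      using resolution_complex[OF resb, of 0] by simp
  qed (use that in auto)
  let ?m = "\<lambda>i. length (target_shifts a i)" and ?c = "cone_shifts s a b"
  \<comment> \<open>The lift reindexed to start with multiplication by \<open>f\<close> from S(-s)
    to S. With the blocks \<open>A i\<close>, \<open>\<phi> i\<close>, 0 and \<open>D i\<close>, the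
    minus sign in \<open>D\<close> is what makes consecutive cone maps compose to zero;
    \<open>rs 0 = []\<close> because the cone is augmented to S alone.\<close>
  define \<phi> where "\<phi> i = (case i of 0 \<Rightarrow> Matrix.mat 1 1 (\<lambda>_. f) | Suc j \<Rightarrow> \<Phi> j)" for i
  define rs where "rs i = (case i of 0 \<Rightarrow> [] | Suc j \<Rightarrow> map (\<lambda>x. x + s) (target_shifts b j))" for i
  define D where "D i = (case i of 0 \<Rightarrow> 0\<^sub>m 0 1 | Suc j \<Rightarrow> - B j)" for i
  define C where "C i = four_block_mat (A i) (\<phi> i) (0\<^sub>m (length (rs i)) (length (a i))) (D i)" for i
  have g\<phi>: "gmat n (target_shifts a i) (map (\<lambda>x. x + s) (target_shifts b i)) (\<phi> i)" for i
    using gF \<Phi>(1) by (cases i) (simp_all add: \<phi>_def)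
  have gD: "gmat n (rs i) (map (\<lambda>x. x + s) (target_shifts b i)) (D i)" for i
    using gmat_uminus[OF gmat_shift[OF gB]] by (cases i) (simp_all add: rs_def D_def gmat_def)
  have ts: "target_shifts ?c i = target_shifts a i @ rs i" for i
    by (cases i) (simp_all add: rs_def cone_shifts_def)
  have gC: "gmat n (target_shifts ?c i) (?c i) (C i)" for i
    unfolding ts C_def cone_shifts_def by (intro gmat_four_block gA g\<phi> gD gmat_zero)
  note cA = gmat_carrier[OF gA] and cB = gmat_carrier[OF gB] and c\<Phi> = gmat_carrier[OF \<Phi>(1)]
    and c\<phi> = gmat_carrier[OF g\<phi>] and cD = gmat_carrier[OF gD]
  note cA' = resolution_carrier(2)[OF resa]
  \<comment> \<open>With the shifted indexing, one relation covers both the augmentation square and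
    all later squares.\<close>
  have rel: "A i * \<Phi> i = \<phi> i * B i" for i
    using \<Phi> by (cases i) (simp_all add: \<phi>_def)
  have C_vec: "C i *\<^sub>v (v @\<^sub>v w) = (A i *\<^sub>v v + \<phi> i *\<^sub>v w) @\<^sub>v (D i *\<^sub>v w)"
    if v: "v \<in> carrier_vec (length (a i))" and w: "w \<in> carrier_vec (length (target_shifts b i))" for i v w
  proof -
    have "C i *\<^sub>v (v @\<^sub>v w) = (A i *\<^sub>v v + \<phi> i *\<^sub>v w) @\<^sub>v (0\<^sub>m (length (rs i)) (length (a i)) *\<^sub>v v + D i *\<^sub>v w)"
      unfolding C_def
      using four_block_mat_mult_vec[OF cA c\<phi> _ cD v, of "0\<^sub>m (length (rs i)) (length (a i))" w] w by simp
    also have "0\<^sub>m (length (rs i)) (length (a i)) *\<^sub>v v + D i *\<^sub>v w = D i *\<^sub>v w"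
      using v w cD[of i] by (auto intro!: eq_vecI)
    finally show ?thesis .
  qed
  have "(\<lambda>v. (C 0 *\<^sub>v v) $ 0) ` free_module n (length (?c 0)) = {p + f * q |p q. p \<in> I \<and> q \<in> poly_carrier n}"
  proof -
    have C0: "(C 0 *\<^sub>v (v @\<^sub>v w)) $ 0 = (A 0 *\<^sub>v v) $ 0 + f * w $ 0"
      if "v \<in> free_module n (length (a 0))" "w \<in> free_module n 1" for v w
    proof -
      have "v \<in> carrier_vec (length (a 0))" "w \<in> carrier_vec 1" using that free_module_carrier by auto
      then show ?thesis
        using cA[of 0] by (subst C_vec) (auto simp: \<phi>_def scalar_prod_def D_def)
    qed
    have len: "length (?c 0) = length (a 0) + 1" by (simp add: cone_shifts_def)
    show ?thesis
    proof (intro equalityI subsetI)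
      fix p assume "p \<in> (\<lambda>v. (C 0 *\<^sub>v v) $ 0) ` free_module n (length (?c 0))"
      then obtain z where z: "z \<in> free_module n (length (a 0) + 1)" "p = (C 0 *\<^sub>v z) $ 0"
        unfolding len by blast
      obtain v w where "v \<in> free_module n (length (a 0))" "w \<in> free_module n 1" "z = v @\<^sub>v w"
        using z(1) by (rule free_module_appendE)
      moreover from this(1) have "(A 0 *\<^sub>v v) $ 0 \<in> I" using resolution_image[OF resa] by auto
      moreover have "w $ 0 \<in> poly_carrier n" using \<open>w \<in> free_module n 1\<close> by (simp add: free_module_def)
      ultimately show "p \<in> {p + f * q |p q. p \<in> I \<and> q \<in> poly_carrier n}" using C0 z(2) by auto
    next
      fix p assume "p \<in> {p + f * q |p q. p \<in> I \<and> q \<in> poly_carrier n}"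
      then obtain v q where v: "v \<in> free_module n (length (a 0))" "q \<in> poly_carrier n" "p = (A 0 *\<^sub>v v) $ 0 + f * q"
        unfolding resolution_image[OF resa, symmetric] by auto
      then have w: "vec 1 (\<lambda>_. q) \<in> free_module n 1" by (simp add: free_module_def)
      have "p = (C 0 *\<^sub>v (v @\<^sub>v vec 1 (\<lambda>_. q))) $ 0" using C0[OF v(1) w] v(3) by simp
      then show "p \<in> (\<lambda>v. (C 0 *\<^sub>v v) $ 0) ` free_module n (length (?c 0))"
        unfolding len using free_module_append[OF v(1) w] by blast
    qed
  qed
  moreover have "(\<lambda>v. C (Suc i) *\<^sub>v v) ` free_module n (length (?c (Suc i))) =
      {v \<in> free_module n (length (?c i)). C i *\<^sub>v v = 0\<^sub>v (length (target_shifts ?c i))}" for i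
  proof (intro equalityI subsetI)
    have len: "length (?c i) = length (a i) + length (target_shifts b i)" for i by (simp add: cone_shifts_def)
    have C_Suc: "C (Suc i) *\<^sub>v (v @\<^sub>v w) = (A (Suc i) *\<^sub>v v + \<Phi> i *\<^sub>v w) @\<^sub>v - (B i *\<^sub>v w)"
      if "v \<in> free_module n (length (a (Suc i)))" "w \<in> free_module n (length (b i))" for v w
    proof -
      have "v \<in> carrier_vec (length (a (Suc i)))" "w \<in> carrier_vec (length (b i))"
        using that free_module_carrier by auto
      then show ?thesis
        by (subst C_vec) (simp_all add: \<phi>_def D_def uminus_mult_mat_vec[OF cB])
    qed
    have A\<Phi>: "A i *\<^sub>v (\<Phi> i *\<^sub>v w) = \<phi> i *\<^sub>v (B i *\<^sub>v w)" if "w \<in> carrier_vec (length (b i))" for w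
      using assoc_mult_mat_vec[OF cA, of "\<Phi> i" i "length (b i)" w]
        assoc_mult_mat_vec[OF c\<phi>, of "B i" i "length (b i)" w] c\<Phi>[of i] cB[of i] that rel[of i] by simp
    have C_zero: "C i *\<^sub>v (x @\<^sub>v y) = 0\<^sub>v (length (target_shifts ?c i)) \<longleftrightarrow>
        A i *\<^sub>v x + \<phi> i *\<^sub>v y = 0\<^sub>v (?m i) \<and> D i *\<^sub>v y = 0\<^sub>v (length (rs i))"
      if "x \<in> carrier_vec (length (a i))" "y \<in> carrier_vec (length (target_shifts b i))" for x y
    proof -
      have zero: "0\<^sub>v (length (target_shifts ?c i)) = 0\<^sub>v (?m i) @\<^sub>v 0\<^sub>v (length (rs i))"
        by (auto simp: ts)
      have "A i *\<^sub>v x + \<phi> i *\<^sub>v y \<in> carrier_vec (?m i)"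
        using mult_mat_vec_carrier[OF cA that(1)] mult_mat_vec_carrier[OF c\<phi>, of y i] that(2) by simp
      then show ?thesis
        unfolding C_vec[OF that] zero by (rule append_vec_eq) simp
    qed
    {
      fix z assume "z \<in> (\<lambda>v. C (Suc i) *\<^sub>v v) ` free_module n (length (?c (Suc i)))"
      then obtain v w where v: "v \<in> free_module n (length (a (Suc i)))" and w: "w \<in> free_module n (length (b i))"
        and z: "z = C (Suc i) *\<^sub>v (v @\<^sub>v w)"
        unfolding len by (auto elim: free_module_appendE)
      note vc = free_module_carrier[OF v] and wc = free_module_carrier[OF w]
      let ?x = "A (Suc i) *\<^sub>v v + \<Phi> i *\<^sub>v w" and ?y = "- (B i *\<^sub>v w)"
      have z_mem: "z \<in> free_module n (length (?c i))"
        unfolding z using gmat_mult_vec[OF gC[of "Suc i"]] free_module_append[OF v w] by (simp add: len)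
      have Av: "A i *\<^sub>v (A (Suc i) *\<^sub>v v) = 0\<^sub>v (?m i)"
        using resolution_exact[OF resa, of i] v by blast
      have x: "?x \<in> carrier_vec (length (a i))"
        using mult_mat_vec_carrier[OF cA' vc] mult_mat_vec_carrier[OF c\<Phi>, of w i] wc by simp
      have Bw: "B i *\<^sub>v w \<in> carrier_vec (length (target_shifts b i))"
        by (rule mult_mat_vec_carrier[OF cB wc])
      have \<phi>B: "\<phi> i *\<^sub>v (B i *\<^sub>v w) \<in> carrier_vec (?m i)" using mult_mat_vec_carrier[OF c\<phi>, of _ i] Bw by simp
      have "A i *\<^sub>v ?x = \<phi> i *\<^sub>v (B i *\<^sub>v w)"
        using mult_add_distrib_mat_vec[OF cA mult_mat_vec_carrier[OF cA' vc], of "\<Phi> i *\<^sub>v w"]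
          mult_mat_vec_carrier[OF c\<Phi>, of w i] wc Av A\<Phi>[OF wc] \<phi>B by simp
      then have "A i *\<^sub>v ?x + \<phi> i *\<^sub>v ?y = 0\<^sub>v (?m i)"
        using uminus_mult_mat_vec(2)[OF c\<phi>, of "B i *\<^sub>v w" i] Bw \<phi>B by simp
      moreover have "D i *\<^sub>v ?y = 0\<^sub>v (length (rs i))"
      proof (cases i)
        case 0
        then show ?thesis by (auto simp: D_def rs_def intro!: eq_vecI)
      next
        case (Suc j)
        have "B j *\<^sub>v (B i *\<^sub>v w) = 0\<^sub>v (length (target_shifts b j))"
          using resolution_exact[OF resb, of j] w Suc by blast
        then show ?thesis
          using Bw Suc uminus_mult_mat_vec[OF cB] by (simp add: D_def rs_def)
      qed
      ultimately have "C i *\<^sub>v z = 0\<^sub>v (length (target_shifts ?c i))"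
        unfolding z C_Suc[OF v w] using C_zero[OF x] Bw by simp
      then show "z \<in> {v \<in> free_module n (length (?c i)). C i *\<^sub>v v = 0\<^sub>v (length (target_shifts ?c i))}"
        using z_mem by simp
    next
      fix z assume "z \<in> {v \<in> free_module n (length (?c i)). C i *\<^sub>v v = 0\<^sub>v (length (target_shifts ?c i))}"
      then obtain x y where x: "x \<in> free_module n (length (a i))" and y: "y \<in> free_module n (length (target_shifts b i))"
        and z: "z = x @\<^sub>v y" "C i *\<^sub>v (x @\<^sub>v y) = 0\<^sub>v (length (target_shifts ?c i))"
        unfolding len by (auto elim: free_module_appendE)
      note xc = free_module_carrier[OF x] and yc = free_module_carrier[OF y]
      have xy: "A i *\<^sub>v x + \<phi> i *\<^sub>v y = 0\<^sub>v (?m i)" and Dy: "D i *\<^sub>v y = 0\<^sub>v (length (rs i))"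
        using z(2) C_zero[OF xc yc] by auto
      \<comment> \<open>The second component of a cycle is handled alone: for \<open>i > 0\<close>
        it is a cycle of \<open>B\<close>, and for \<open>i = 0\<close> the first block equation
        reads \<open>f * (- y) = A 0 x\<close>, so \<open>- y\<close> lies in the colon ideal
        \<open>J\<close>.\<close>
      have "\<exists>w\<in>free_module n (length (b i)). B i *\<^sub>v w = - y"
      proof (cases i)
        case 0
        have "(A 0 *\<^sub>v x + \<phi> 0 *\<^sub>v y) $ 0 = 0" using xy 0 by simp
        then have "(A 0 *\<^sub>v x) $ 0 + f * y $ 0 = 0"
          using yc 0 by (simp add: \<phi>_def scalar_prod_def)
        then have "f * - y $ 0 = (A 0 *\<^sub>v x) $ 0"
          using eq_neg_iff_add_eq_0[of "(A 0 *\<^sub>v x) $ 0" "f * y $ 0"] by simp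
        then have "f * - y $ 0 \<in> I"
          using x 0 unfolding resolution_image[OF resa, symmetric] by auto
        then have "- y $ 0 \<in> J" using y 0 by (auto simp: J free_module_def)
        then obtain w where w: "w \<in> free_module n (length (b 0))" "(B 0 *\<^sub>v w) $ 0 = - y $ 0"
          unfolding resolution_image[OF resb, symmetric] by auto
        have "B 0 *\<^sub>v w = - y" using w(2) yc 0 cB0 by (intro eq_vecI) auto
        then show ?thesis using w 0 by blast
      next
        case (Suc j)
        have "B j *\<^sub>v - y = 0\<^sub>v (length (target_shifts b j))"
          using Dy yc Suc uminus_mult_mat_vec[OF cB, of y j] by (simp add: D_def rs_def)
        then have "- y \<in> {v \<in> free_module n (length (b j)). B j *\<^sub>v v = 0\<^sub>v (length (target_shifts b j))}"
          using y Suc free_module_uminus by auto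
        then show ?thesis
          unfolding resolution_exact[OF resb, of j, symmetric] Suc by auto
      qed
      then obtain w where w: "w \<in> free_module n (length (b i))" and Bw: "B i *\<^sub>v w = - y" by blast
      note wc = free_module_carrier[OF w]
      have \<Phi>w: "\<Phi> i *\<^sub>v w \<in> free_module n (length (a i))"
        using gmat_mult_vec[OF \<Phi>(1), of w i] w by simp
      \<comment> \<open>Once \<open>w\<close> accounts for \<open>y\<close>, correcting
        \<open>x\<close> by \<open>\<Phi> i *\<^sub>v w\<close> leaves a cycle of \<open>A\<close>,
        whose preimage is the first component sought.\<close>
      have "A i *\<^sub>v (x - \<Phi> i *\<^sub>v w) = A i *\<^sub>v x - \<phi> i *\<^sub>v - y"
        using mult_minus_distrib_mat_vec[OF cA xc free_module_carrier[OF \<Phi>w]] A\<Phi>[OF wc] Bw by simp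
      also have "\<dots> = A i *\<^sub>v x + \<phi> i *\<^sub>v y"
        using uminus_mult_mat_vec(2)[OF c\<phi>, of y i] yc mult_mat_vec_carrier[OF cA xc]
          mult_mat_vec_carrier[OF c\<phi>, of y i] by (auto intro!: eq_vecI)
      finally have "x - \<Phi> i *\<^sub>v w \<in> {v \<in> free_module n (length (a i)). A i *\<^sub>v v = 0\<^sub>v (?m i)}"
        using xy free_module_minus[OF x \<Phi>w] by simp
      then obtain v where v: "v \<in> free_module n (length (a (Suc i)))" "A (Suc i) *\<^sub>v v = x - \<Phi> i *\<^sub>v w"
        unfolding resolution_exact[OF resa, of i, symmetric] by auto
      have "A (Suc i) *\<^sub>v v + \<Phi> i *\<^sub>v w = x"
        unfolding v(2) by (rule vec_minus_add_cancel[OF xc free_module_carrier[OF \<Phi>w]])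
      then have "z = C (Suc i) *\<^sub>v (v @\<^sub>v w)"
        unfolding C_Suc[OF v(1) w] z(1) Bw by simp
      then show "z \<in> (\<lambda>v. C (Suc i) *\<^sub>v v) ` free_module n (length (?c (Suc i)))"
        unfolding len target_shifts_simps
        using free_module_append[OF v(1) w] by (rule image_eqI)
    }
  qed
  ultimately have "graded_free_resolution n {p + f * q |p q. p \<in> I \<and> q \<in> poly_carrier n} ?c C"
    unfolding graded_free_resolution_def using gC[unfolded gmat_def] by simp
  then show ?thesis by blast
qed

section \<open>Linear quotients\<close>

definition mono_dvd :: "monomial \<Rightarrow> monomial \<Rightarrow> bool"
  where "mono_dvd u m \<longleftrightarrow> (\<forall>i. Poly_Mapping.lookup u i \<le> Poly_Mapping.lookup m i)"

lemma mono_dvd_refl [simp]: "mono_dvd u u"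
  by (simp add: mono_dvd_def)

lemma mono_dvd_trans: "mono_dvd u v \<Longrightarrow> mono_dvd v w \<Longrightarrow> mono_dvd u w"
  unfolding mono_dvd_def using le_trans by blast

lemma mono_dvd_add: "mono_dvd u m \<Longrightarrow> u + (m - u) = m"
  by (rule poly_mapping_eqI) (simp add: mono_dvd_def lookup_add lookup_minus)

lemma mono_dvd_add_right [simp]: "mono_dvd u (u + w)"
  by (simp add: mono_dvd_def lookup_add)

lemma mono_dvd_single_one: "mono_dvd (Poly_Mapping.single i 1) m \<longleftrightarrow> i \<in> Poly_Mapping.keys m"
  by (auto simp: mono_dvd_def lookup_single when_def in_keys_iff)

lemma mdeg_mono: "mono_dvd u m \<Longrightarrow> mdeg u \<le> mdeg m"
  by (metis mono_dvd_add mdeg_add le_add1)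

lemma lookup_single_mult:
  fixes q :: "'k::field mpoly"
  shows "Poly_Mapping.lookup (Poly_Mapping.single u c * q) m =
    (if mono_dvd u m then c * Poly_Mapping.lookup q (m - u) else 0)"
proof -
  have "Poly_Mapping.lookup (Poly_Mapping.single u c * q) m =
      (\<Sum>l. c * (\<Sum>r. Poly_Mapping.lookup q r when m = u + r) when l = u)"
    unfolding lookup_mult by (rule Sum_any.cong) (simp add: lookup_single when_def)
  also have "\<dots> = c * (\<Sum>r. Poly_Mapping.lookup q r when m = u + r)" by simp
  also have "(\<Sum>r. Poly_Mapping.lookup q r when m = u + r) =
      (if mono_dvd u m then Poly_Mapping.lookup q (m - u) else 0)"
  proof (cases "mono_dvd u m")
    case True
    then have "m = u + r \<longleftrightarrow> r = m - u" for r
      using mono_dvd_add[OF True] by (metis add_left_cancel)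
    then show ?thesis using True by simp
  next
    case False
    then have "m \<noteq> u + r" for r by auto
    then show ?thesis using False by simp
  qed
  finally show ?thesis by simp
qed

lemma keys_mono_poly_mult:
  fixes q :: "'k::field mpoly"
  shows "Poly_Mapping.keys (mono_poly u * q) = (+) u ` Poly_Mapping.keys q"
proof -
  have "m \<in> Poly_Mapping.keys (mono_poly u * q) \<longleftrightarrow> mono_dvd u m \<and> m - u \<in> Poly_Mapping.keys q" for m
    by (simp add: in_keys_iff lookup_single_mult)
  moreover have "m \<in> (+) u ` Poly_Mapping.keys q \<longleftrightarrow> mono_dvd u m \<and> m - u \<in> Poly_Mapping.keys q" for m
  proof
    assume "mono_dvd u m \<and> m - u \<in> Poly_Mapping.keys q"
    then show "m \<in> (+) u ` Poly_Mapping.keys q"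
      using mono_dvd_add[of u m] by (intro image_eqI[of _ _ "m - u"]) simp_all
  qed auto
  ultimately show ?thesis by blast
qed

text \<open>Membership is a condition on the support rather than a generation statement, so sums and
  colon ideals can be computed monomial by monomial. \<open>genideal_eq_monomial_ideal\<close>
  connects it with generated ideals.\<close>

definition monomial_ideal :: "nat \<Rightarrow> monomial set \<Rightarrow> 'k::field mpoly set"
  where "monomial_ideal n U = {p \<in> poly_carrier n. \<forall>m\<in>Poly_Mapping.keys p. \<exists>u\<in>U. mono_dvd u m}"

lemma mono_poly_carrier: "mono_poly u \<in> poly_carrier n \<longleftrightarrow> Poly_Mapping.keys u \<subseteq> {1..n}"
  by (simp add: poly_carrier_iff)

lemma mono_poly_mem_monomial_ideal:
  "mono_poly m \<in> monomial_ideal n U \<longleftrightarrow> Poly_Mapping.keys m \<subseteq> {1..n} \<and> (\<exists>u\<in>U. mono_dvd u m)"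
  by (simp add: monomial_ideal_def mono_poly_carrier)

lemma monomial_ideal_empty: "monomial_ideal n {} = {0}"
  by (auto simp: monomial_ideal_def)

lemma monomial_ideal_insert:
  assumes u: "Poly_Mapping.keys u \<subseteq> {1..n}"
  shows "monomial_ideal n (insert u U) =
    {p + mono_poly u * q |p q. p \<in> monomial_ideal n U \<and> q \<in> poly_carrier n}"
proof (intro equalityI subsetI)
  fix p :: "'a mpoly" assume p: "p \<in> monomial_ideal n (insert u U)"
  \<comment> \<open>\<open>p1\<close> collects all terms divisible by something in \<open>U\<close>,
    including those also divisible by \<open>u\<close>. The remaining terms are multiples of
    \<open>u\<close>, and \<open>map_key\<close> with \<open>(+) u\<close> divides them by
    \<open>u\<close>.\<close>
  define p1 where "p1 = Poly_Mapping.mapp (\<lambda>m c. c when (\<exists>v\<in>U. mono_dvd v m)) p"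
  define q where "q = Poly_Mapping.map_key ((+) u) (p - p1)"
  have l1: "Poly_Mapping.lookup p1 m = (Poly_Mapping.lookup p m when (\<exists>v\<in>U. mono_dvd v m))" for m
    by (auto simp: p1_def lookup_mapp in_keys_iff when_def)
  have lq: "Poly_Mapping.lookup q w = Poly_Mapping.lookup (p - p1) (u + w)" for w
    by (simp add: q_def map_key.rep_eq inj_on_def)
  have "p1 \<in> monomial_ideal n U"
    using p by (auto simp: monomial_ideal_def poly_carrier_iff in_keys_iff l1 when_def split: if_splits)
  moreover have "q \<in> poly_carrier n"
    unfolding poly_carrier_iff
  proof
    fix w assume "w \<in> Poly_Mapping.keys q"
    then have "u + w \<in> Poly_Mapping.keys p"
      by (auto simp: in_keys_iff lq lookup_minus l1 when_def split: if_splits)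
    then have "Poly_Mapping.keys (u + w) \<subseteq> {1..n}"
      using p unfolding monomial_ideal_def poly_carrier_iff by blast
    then show "Poly_Mapping.keys w \<subseteq> {1..n}" by (simp add: keys_add_nat)
  qed
  moreover have "p = p1 + mono_poly u * q"
  proof (rule poly_mapping_eqI)
    fix m
    show "Poly_Mapping.lookup p m = Poly_Mapping.lookup (p1 + mono_poly u * q) m"
    proof (cases "mono_dvd u m")
      case True
      then show ?thesis by (simp add: lookup_add lookup_single_mult lq mono_dvd_add lookup_minus)
    next
      case False
      then have "Poly_Mapping.lookup p m = 0 \<or> (\<exists>v\<in>U. mono_dvd v m)"
        using p by (auto simp: monomial_ideal_def in_keys_iff)
      then show ?thesis using False by (auto simp: lookup_add lookup_single_mult l1 when_def)
    qed
  qed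
  ultimately show "p \<in> {p + mono_poly u * q |p q. p \<in> monomial_ideal n U \<and> q \<in> poly_carrier n}" by blast
next
  fix r :: "'a mpoly"
  assume "r \<in> {p + mono_poly u * q |p q. p \<in> monomial_ideal n U \<and> q \<in> poly_carrier n}"
  then obtain p q where p: "p \<in> monomial_ideal n U" and q: "q \<in> poly_carrier n" and r: "r = p + mono_poly u * q"
    by blast
  have "r \<in> poly_carrier n"
    unfolding r using p q u by (intro poly_carrier_add poly_carrier_mult) (auto simp: monomial_ideal_def mono_poly_carrier)
  moreover have "\<exists>v\<in>insert u U. mono_dvd v m" if "m \<in> Poly_Mapping.keys r" for m
  proof -
    have "m \<in> Poly_Mapping.keys p \<or> m \<in> Poly_Mapping.keys (mono_poly u * q)"
      using that Poly_Mapping.keys_add[of p "mono_poly u * q"] unfolding r by blast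
    then show ?thesis using p by (auto simp: monomial_ideal_def keys_mono_poly_mult)
  qed
  ultimately show "r \<in> monomial_ideal n (insert u U)" by (simp add: monomial_ideal_def)
qed

lemma monomial_ideal_colon:
  assumes "Poly_Mapping.keys u \<subseteq> {1..n}"
  shows "{p \<in> poly_carrier n. mono_poly u * p \<in> monomial_ideal n U} =
    {p \<in> poly_carrier n. \<forall>m\<in>Poly_Mapping.keys p. \<exists>v\<in>U. mono_dvd v (u + m)}"
  using assms poly_carrier_mult[of "mono_poly u" n]
  by (auto simp: monomial_ideal_def keys_mono_poly_mult mono_poly_carrier)

text \<open>The hypothesis \<open>colon\<close> says that \<open>W\<close> generates the colon ideal
  of \<open>U\<close> by \<open>u\<close>. Testing it on monomials is enough, since multiplication
  by \<open>u\<close> merely translates supports.\<close>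

lemma resolution_insert:
  assumes u: "Poly_Mapping.keys u \<subseteq> {1..n}"
    and resa: "graded_free_resolution n (monomial_ideal n U :: 'k::field mpoly set) a A"
    and resb: "graded_free_resolution n (monomial_ideal n W :: 'k mpoly set) b B"
    and colon: "\<And>m. Poly_Mapping.keys m \<subseteq> {1..n} \<Longrightarrow>
      (\<exists>v\<in>U. mono_dvd v (u + m)) \<longleftrightarrow> (\<exists>w\<in>W. mono_dvd w m)"
  shows "\<exists>C. graded_free_resolution n (monomial_ideal n (insert u U) :: 'k mpoly set) (cone_shifts (mdeg u) a b) C"
  unfolding monomial_ideal_insert[OF u]
proof (rule mapping_cone[OF resa resb])
  show "monomial_ideal n W = {p \<in> poly_carrier n. mono_poly u * p \<in> (monomial_ideal n U :: 'k mpoly set)}"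
    unfolding monomial_ideal_colon[OF u] using colon by (auto simp: monomial_ideal_def poly_carrier_iff)
qed (use u in \<open>simp_all add: mono_poly_carrier\<close>)

section \<open>Iterated cones, from the zero ideal to linear quotients\<close>

lemma free_module_0: "free_module n 0 = {0\<^sub>v 0}"
  by (auto simp: free_module_def intro!: eq_vecI)

lemma resolution_zero:
  "\<exists>A. graded_free_resolution n ({0} :: 'k::field mpoly set) (\<lambda>_. []) A"
proof
  let ?A = "\<lambda>i. 0\<^sub>m (length (target_shifts (\<lambda>_. []) i)) 0 :: 'k mpoly mat"
  have "?A i *\<^sub>v 0\<^sub>v 0 = 0\<^sub>v (length (target_shifts (\<lambda>_. []) i))" for i
    by (rule eq_vecI) (simp_all add: scalar_prod_def)
  moreover have "0\<^sub>m 0 0 *\<^sub>v 0\<^sub>v 0 = (0\<^sub>v 0 :: 'k mpoly vec)"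
    by (rule eq_vecI) simp_all
  ultimately show "graded_free_resolution n ({0} :: 'k mpoly set) (\<lambda>_. []) ?A"
    unfolding graded_free_resolution_def by (auto simp: free_module_0)
qed

text \<open>The Koszul resolution, one variable at a time: a new variable is a nonzerodivisor modulo
  the old ones, so the colon ideal is the old ideal and the cone is formed from two copies of its
  resolution. The shifts are \<open>Suc i\<close> because the ideal itself is resolved, with its
  generators in homological degree 0.\<close>

lemma resolution_variables:
  assumes "finite V" "V \<subseteq> {1..n}"
  shows "\<exists>a A. graded_free_resolution n
      (monomial_ideal n ((\<lambda>i. Poly_Mapping.single i 1) ` V) :: 'k::field mpoly set) a A \<and>
    (\<forall>i. set (a i) \<subseteq> {Suc i})"
  using assms
proof (induction V)
  case empty
  obtain A where "graded_free_resolution n ({0} :: 'k mpoly set) (\<lambda>_. []) A"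
    using resolution_zero by blast
  then show ?case by (intro exI[of _ "\<lambda>_. []"] exI[of _ A]) (simp add: monomial_ideal_empty)
next
  case (insert x V)
  let ?x = "\<lambda>i. Poly_Mapping.single i 1 :: monomial"
  obtain a A where res: "graded_free_resolution n (monomial_ideal n (?x ` V) :: 'k mpoly set) a A"
    and a: "\<And>i. set (a i) \<subseteq> {Suc i}"
    using insert by auto
  have "(\<exists>v\<in>?x ` V. mono_dvd v (?x x + m)) \<longleftrightarrow> (\<exists>w\<in>?x ` V. mono_dvd w m)" for m
    using insert.hyps(2) mono_dvd_single_one by (auto simp: keys_add_nat)
  then obtain C where C: "graded_free_resolution n (monomial_ideal n (insert (?x x) (?x ` V)) :: 'k mpoly set)
      (cone_shifts (mdeg (?x x)) a a) C"
    using resolution_insert[OF _ res res, of "?x x"] insert.prems by auto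
  have "set (cone_shifts (mdeg (?x x)) a a i) \<subseteq> {Suc i}" for i
    using a[of i] a[of "i - 1"] by (cases i) (auto simp: cone_shifts_def)
  then show ?case using C by auto
qed

text \<open>In \<open>quot\<close>, the exponent of \<open>x_q\<close> is larger in \<open>v\<close>
  than in \<open>u\<close>, so \<open>v\<close> dividing \<open>u m\<close> forces
  \<open>x_q\<close> to divide \<open>m\<close>, while \<open>w\<close> already divides
  \<open>u x_q\<close>. Hence each colon ideal is generated by variables. A cone adds
  \<open>mdeg u\<close> to their shifts, which grow by one per homological degree.\<close>

lemma resolution_linear_quotients:
  fixes f :: "monomial \<Rightarrow> nat"
  assumes fin: "finite U" and keys: "\<And>u. u \<in> U \<Longrightarrow> Poly_Mapping.keys u \<subseteq> {1..n}"
    and quot: "\<And>u v. u \<in> U \<Longrightarrow> v \<in> U \<Longrightarrow> v \<noteq> u \<Longrightarrow> f v \<le> f u \<Longrightarrow>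
      \<exists>w\<in>U. f w < f u \<and> (mono_dvd w u \<or>
        (\<exists>q. mono_dvd w (u + Poly_Mapping.single q 1) \<and> Poly_Mapping.lookup u q < Poly_Mapping.lookup v q))"
  shows "\<exists>a A. graded_free_resolution n (monomial_ideal n U :: 'k::field mpoly set) a A \<and>
    (\<forall>i. \<forall>e\<in>set (a i). \<exists>u\<in>U. e = mdeg u + i)"
proof -
  \<comment> \<open>The induction runs over subsets closed under strictly smaller rank. Elements of
    equal rank may enter in any order, since the witness \<open>w\<close> of \<open>quot\<close> has
    strictly smaller rank and is therefore already present.\<close>
  have "S \<subseteq> U \<Longrightarrow> (\<And>x y. x \<in> S \<Longrightarrow> y \<in> U \<Longrightarrow> f y < f x \<Longrightarrow> y \<in> S) \<Longrightarrow>
    \<exists>a A. graded_free_resolution n (monomial_ideal n S :: 'k mpoly set) a A \<and>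
      (\<forall>i. \<forall>e\<in>set (a i). \<exists>u\<in>S. e = mdeg u + i)" if "finite S" for S
    using that
  proof (induction S rule: finite_ranking_induct[where f = f])
    case empty
    obtain A where "graded_free_resolution n ({0} :: 'k mpoly set) (\<lambda>_. []) A"
      using resolution_zero by blast
    then show ?case by (intro exI[of _ "\<lambda>_. []"] exI[of _ A]) (simp add: monomial_ideal_empty)
  next
    case (insert u S)
    have initial: "y \<in> S" if "x \<in> S" "y \<in> U" "f y < f x" for x y
      using insert.hyps(2)[OF that(1)] insert.prems(2)[of x y] that by auto
    obtain a A where res: "graded_free_resolution n (monomial_ideal n S :: 'k mpoly set) a A"
      and a: "\<And>i e. e \<in> set (a i) \<Longrightarrow> \<exists>u\<in>S. e = mdeg u + i"
      using insert.IH insert.prems(1) initial by auto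
    have uU: "u \<in> U" and u: "Poly_Mapping.keys u \<subseteq> {1..n}" using insert.prems(1) keys by auto
    show ?case
    proof (cases "\<exists>w\<in>S. mono_dvd w u")
      case True
      then have "monomial_ideal n (insert u S) = (monomial_ideal n S :: 'k mpoly set)"
        using mono_dvd_trans by (fastforce simp: monomial_ideal_def)
      then show ?thesis using res a by (intro exI[of _ a] exI[of _ A]) auto
    next
      case False
      let ?x = "\<lambda>i. Poly_Mapping.single i 1 :: monomial"
      define V where "V = {q \<in> {1..n}. \<exists>w\<in>S. mono_dvd w (u + ?x q)}"
      have "finite V" "V \<subseteq> {1..n}" by (auto simp: V_def)
      then obtain b B where resb: "graded_free_resolution n (monomial_ideal n (?x ` V) :: 'k mpoly set) b B"
        and b: "\<And>i. set (b i) \<subseteq> {Suc i}"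
        using resolution_variables[of V n] by blast
      have "(\<exists>v\<in>S. mono_dvd v (u + m)) \<longleftrightarrow> (\<exists>w\<in>?x ` V. mono_dvd w m)" for m
      proof
        assume "\<exists>v\<in>S. mono_dvd v (u + m)"
        then obtain v where v: "v \<in> S" "mono_dvd v (u + m)" by blast
        then have vU: "v \<in> U" and "v \<noteq> u" and "f v \<le> f u"
          using insert.prems(1) insert.hyps(2) False by auto
        then obtain w where w: "w \<in> U" "f w < f u"
          and alt: "mono_dvd w u \<or> (\<exists>q. mono_dvd w (u + ?x q) \<and> Poly_Mapping.lookup u q < Poly_Mapping.lookup v q)"
          using quot[OF uU] by blast
        have wS: "w \<in> S" using insert.prems(2)[of u w] w by auto
        with alt False obtain q where q: "mono_dvd w (u + ?x q)" "Poly_Mapping.lookup u q < Poly_Mapping.lookup v q"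
          by blast
        then have "q \<in> Poly_Mapping.keys v" by (auto simp: in_keys_iff)
        then have "q \<in> V" using q wS keys[OF vU] by (auto simp: V_def)
        moreover have "q \<in> Poly_Mapping.keys m"
        proof -
          have "Poly_Mapping.lookup v q \<le> Poly_Mapping.lookup u q + Poly_Mapping.lookup m q"
            using v(2) by (simp add: mono_dvd_def lookup_add)
          then show ?thesis using q(2) by (simp add: in_keys_iff)
        qed
        ultimately show "\<exists>w\<in>?x ` V. mono_dvd w m" using mono_dvd_single_one by blast
      next
        assume "\<exists>w\<in>?x ` V. mono_dvd w m"
        then obtain q w where "q \<in> Poly_Mapping.keys m" and w: "w \<in> S" "mono_dvd w (u + ?x q)"
          by (auto simp: V_def mono_dvd_single_one[unfolded One_nat_def])
        then have "mono_dvd (?x q) m" using mono_dvd_single_one by blast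
        then have "mono_dvd (u + ?x q) (u + m)" by (simp add: mono_dvd_def lookup_add)
        then show "\<exists>v\<in>S. mono_dvd v (u + m)" using w mono_dvd_trans by blast
      qed
      then obtain C where C: "graded_free_resolution n (monomial_ideal n (insert u S) :: 'k mpoly set)
          (cone_shifts (mdeg u) a b) C"
        using resolution_insert[OF u res resb] by blast
      have "\<exists>v\<in>insert u S. e = mdeg v + i" if "e \<in> set (cone_shifts (mdeg u) a b i)" for i e
        using that a[of e i] b[of "i - 1"] by (cases i) (auto simp: cone_shifts_def)
      then show ?thesis using C by blast
    qed
  qed
  from this[OF fin] show ?thesis by simp
qed

text \<open>Exhibiting one resolution ensures that the choice in \<open>betti\<close> picks a
  genuine one, to which the comparison applies.\<close>

lemma betti_eq_0:
  assumes res: "graded_free_resolution n I a A" and e: "e \<notin> set (a i)"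
  shows "betti n I i e = 0"
proof -
  obtain b B where bB: "(SOME (a, A). graded_free_resolution n I a A) = (b, B)" by fastforce
  have "case (SOME (a, A). graded_free_resolution n I a A) of (a, A) \<Rightarrow> graded_free_resolution n I a A"
    by (rule someI[of _ "(a, A)"]) (simp add: res)
  then have "graded_free_resolution n I b B" by (simp add: bB)
  then show ?thesis using tor_dim_eq_0[OF _ res e] by (simp add: betti_def bB)
qed

section \<open>Identification of \<open>monomial_ideal\<close> with the ideal generated in the
  ring\<close>

lemma ring_poly_ring: "ring (poly_ring n :: 'k::field mpoly ring)"
proof (rule ringI)
  show "abelian_group (poly_ring n :: 'k mpoly ring)"
  proof (rule abelian_groupI)
    fix p :: "'k mpoly" assume "p \<in> poly_carrier n"
    then show "\<exists>q\<in>poly_carrier n. q \<oplus>\<^bsub>poly_ring n\<^esub> p = \<zero>\<^bsub>poly_ring n\<^esub>"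
      by (intro bexI[of _ "- p"]) (auto simp: poly_ring_def in_keys_iff)
  qed (auto simp: poly_ring_def keys_add_nat add.assoc add.commute dest!: subsetD[OF Poly_Mapping.keys_add])
  show "monoid (poly_ring n :: 'k mpoly ring)"
  proof (rule monoidI)
    fix p q :: "'k mpoly" assume "p \<in> poly_carrier n" "q \<in> poly_carrier n"
    then show "p \<otimes>\<^bsub>poly_ring n\<^esub> q \<in> poly_carrier n"
      using poly_carrier_mult[of p n q] by (simp add: poly_ring_def)
  qed (auto simp: poly_ring_def mult.assoc)
qed (auto simp: poly_ring_def algebra_simps)

lemma monomial_ideal_ideal: "ideal (monomial_ideal n U :: 'k::field mpoly set) (poly_ring n)"
proof (rule idealI[OF ring_poly_ring])
  show "subgroup (monomial_ideal n U :: 'k mpoly set) (add_monoid (poly_ring n))"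
  proof (rule group.subgroupI)
    show "Group.group (add_monoid (poly_ring n :: 'k mpoly ring))"
      using ring_poly_ring abelian_group.a_group ring_def by blast
    show "monomial_ideal n U \<noteq> ({} :: 'k mpoly set)"
      using poly_carrier_zero by (force simp: monomial_ideal_def)
    fix p :: "'k mpoly" assume p: "p \<in> monomial_ideal n U"
    then have "p \<in> poly_carrier n" by (simp add: monomial_ideal_def)
    moreover have "- p \<in> monomial_ideal n U"
      using p poly_carrier_uminus[of p n] by (auto simp: monomial_ideal_def in_keys_iff)
    moreover have "- p \<in> poly_carrier n" using \<open>p \<in> poly_carrier n\<close> by (rule poly_carrier_uminus)
    ultimately show "inv\<^bsub>add_monoid (poly_ring n)\<^esub> p \<in> monomial_ideal n U"
      using group.inv_equality[OF \<open>Group.group (add_monoid (poly_ring n))\<close>, of "- p" p]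
      by (simp add: poly_ring_def)
    fix q :: "'k mpoly" assume "q \<in> monomial_ideal n U"
    then show "p \<otimes>\<^bsub>add_monoid (poly_ring n)\<^esub> q \<in> monomial_ideal n U"
      using p poly_carrier_add[of p n q] Poly_Mapping.keys_add[of p q]
      by (fastforce simp: monomial_ideal_def poly_ring_def)
  qed (auto simp: monomial_ideal_def)
next
  fix p x :: "'k mpoly" assume p: "p \<in> monomial_ideal n U" and x: "x \<in> poly_carrier n"
  have "x * p \<in> poly_carrier n" using p x by (auto simp: monomial_ideal_def)
  moreover have "\<exists>u\<in>U. mono_dvd u m" if m: "m \<in> Poly_Mapping.keys (x * p)" for m
  proof -
    obtain v w where w: "w \<in> Poly_Mapping.keys p" and "m = v + w"
      using subsetD[OF Poly_Mapping.keys_mult m] by auto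
    then have "mono_dvd w m" using mono_dvd_add_right[of w v] by (simp add: add.commute)
    moreover obtain u where "u \<in> U" "mono_dvd u w" using p w by (auto simp: monomial_ideal_def)
    ultimately show ?thesis using mono_dvd_trans by blast
  qed
  ultimately have "x * p \<in> monomial_ideal n U" by (simp add: monomial_ideal_def)
  then show "x \<otimes>\<^bsub>poly_ring n\<^esub> p \<in> monomial_ideal n U" "p \<otimes>\<^bsub>poly_ring n\<^esub> x \<in> monomial_ideal n U"
    by (simp_all add: poly_ring_def mult.commute)
qed

lemma genideal_eq_monomial_ideal:
  assumes U: "\<And>u. u \<in> U \<Longrightarrow> Poly_Mapping.keys u \<subseteq> {1..n}"
  shows "Idl\<^bsub>poly_ring n\<^esub> (mono_poly ` U) = (monomial_ideal n U :: 'k::field mpoly set)"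
proof
  interpret ring "poly_ring n :: 'k mpoly ring" by (rule ring_poly_ring)
  have sub: "mono_poly ` U \<subseteq> (monomial_ideal n U :: 'k mpoly set)"
    by (rule image_subsetI) (metis U mono_dvd_refl mono_poly_mem_monomial_ideal)
  then show "Idl\<^bsub>poly_ring n\<^esub> (mono_poly ` U) \<subseteq> (monomial_ideal n U :: 'k mpoly set)"
    by (rule genideal_minimal[OF monomial_ideal_ideal])
  let ?J = "Idl\<^bsub>poly_ring n\<^esub> (mono_poly ` U) :: 'k mpoly set"
  have carr: "mono_poly ` U \<subseteq> (poly_carrier n :: 'k mpoly set)"
    using sub by (auto simp: monomial_ideal_def)
  interpret J: ideal ?J "poly_ring n" by (rule genideal_ideal[OF carr])
  have term_mem: "Poly_Mapping.single m c \<in> ?J"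
    if m: "Poly_Mapping.keys m \<subseteq> {1..n}" "u \<in> U" "mono_dvd u m" for m u and c :: 'k
  proof -
    have "Poly_Mapping.keys (m - u) \<subseteq> {1..n}"
      using m(1) by (auto simp: in_keys_iff lookup_minus)
    then have "Poly_Mapping.single (m - u) c \<in> poly_carrier n" by (simp add: poly_carrier_iff)
    moreover have "mono_poly u \<in> ?J" using genideal_self[OF carr] m(2) by blast
    ultimately have "mono_poly u * Poly_Mapping.single (m - u) c \<in> ?J"
      using J.I_r_closed[of "mono_poly u" "Poly_Mapping.single (m - u) c"] by (simp add: poly_ring_def)
    then show ?thesis using mono_dvd_add[OF m(3)] by (simp add: mult_single)
  qed
  show "monomial_ideal n U \<subseteq> ?J"
  proof
    fix p :: "'k mpoly" assume "p \<in> monomial_ideal n U"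
    then have p: "\<And>m. m \<in> Poly_Mapping.keys p \<Longrightarrow> Poly_Mapping.keys m \<subseteq> {1..n} \<and> (\<exists>u\<in>U. mono_dvd u m)"
      by (auto simp: monomial_ideal_def poly_carrier_iff)
    have zero: "0 \<in> ?J" using J.zero_closed by (simp add: poly_ring_def)
    have add: "q \<in> ?J \<Longrightarrow> r \<in> ?J \<Longrightarrow> q + r \<in> ?J" for q r
      using J.a_closed[of q r] by (simp add: poly_ring_def)
    have sum_mem: "sum (\<lambda>m. Poly_Mapping.single m (Poly_Mapping.lookup p m)) M \<in> ?J"
      if "finite M" "M \<subseteq> Poly_Mapping.keys p" for M
      using that
    proof (induction M)
      case (insert m M)
      then obtain u where "u \<in> U" "mono_dvd u m" "Poly_Mapping.keys m \<subseteq> {1..n}" using p by blast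
      then show ?case using insert by (simp add: add term_mem)
    qed (simp add: zero)
    have p_eq: "p = sum (\<lambda>m. Poly_Mapping.single m (Poly_Mapping.lookup p m)) (Poly_Mapping.keys p)"
      by (rule poly_mapping_eqI) (simp add: lookup_sum lookup_single when_def not_in_keys_iff_lookup_eq_zero)
    show "p \<in> ?J"
      using sum_mem[OF finite_keys subset_refl] by (simp only: p_eq[symmetric])
  qed
qed

section \<open>Spread monomials\<close>

text \<open>The condition on the index list inside \<open>tspread\<close>. Exchange arguments
  compare the j-th indices of two monomials, so they are carried out on lists.\<close>

definition spread :: "nat \<Rightarrow> nat \<Rightarrow> nat list \<Rightarrow> bool"
  where "spread t n xs \<longleftrightarrow>
    sorted xs \<and> set xs \<subseteq> {1..n} \<and> (\<forall>j. Suc j < length xs \<longrightarrow> xs ! j + t \<le> xs ! Suc j)"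

definition mono_of :: "nat list \<Rightarrow> monomial"
  where "mono_of xs = sum_list (map (\<lambda>i. Poly_Mapping.single i 1) xs)"

lemma tspread_iff: "tspread t n u \<longleftrightarrow> (\<exists>xs. spread t n xs \<and> u = mono_of xs)"
  by (auto simp: tspread_def spread_def mono_of_def)

lemma spread_iff:
  "spread t n xs \<longleftrightarrow> (\<forall>j<length xs. 1 \<le> xs ! j \<and> xs ! j \<le> n) \<and>
    (\<forall>j. Suc j < length xs \<longrightarrow> xs ! j + t \<le> xs ! Suc j)"
  unfolding spread_def sorted_iff_nth_Suc
  by (fastforce simp: in_set_conv_nth subset_iff)

lemma spreadD:
  assumes "spread t n xs"
  shows "j < length xs \<Longrightarrow> 1 \<le> xs ! j" "j < length xs \<Longrightarrow> xs ! j \<le> n"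
    "Suc j < length xs \<Longrightarrow> xs ! j + t \<le> xs ! Suc j"
  using assms by (auto simp: spread_iff)

lemma mono_of_append: "mono_of (xs @ ys) = mono_of xs + mono_of ys"
  by (simp add: mono_of_def)

lemma mono_of_Cons: "mono_of (x # xs) = Poly_Mapping.single x 1 + mono_of xs"
  by (simp add: mono_of_def)

lemma mono_of_Nil [simp]: "mono_of [] = 0"
  by (simp add: mono_of_def)

lemma lookup_mono_of: "Poly_Mapping.lookup (mono_of xs) i = count_list xs i"
  by (induction xs) (simp_all add: mono_of_Cons lookup_add lookup_single when_def)

lemma keys_mono_of [simp]: "Poly_Mapping.keys (mono_of xs) = set xs"
  by (auto simp: in_keys_iff lookup_mono_of count_list_0_iff)

lemma mdeg_mono_of [simp]: "mdeg (mono_of xs) = length xs"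
  by (induction xs) (simp_all add: mono_of_Cons)

lemma mono_dvd_take: "mono_dvd (mono_of (take m xs)) (mono_of xs)"
  using mono_dvd_add_right[of "mono_of (take m xs)" "mono_of (drop m xs)"]
  by (simp flip: mono_of_append)

lemma mono_of_update:
  assumes "i < length xs"
  shows "mono_of (xs[i := b]) + Poly_Mapping.single (xs ! i) 1 = mono_of xs + Poly_Mapping.single b 1"
proof -
  have "mono_of xs = mono_of (take i xs @ xs ! i # drop (Suc i) xs)"
    using id_take_nth_drop[OF assms] by simp
  then show ?thesis
    using assms by (simp add: upd_conv_take_nth_drop mono_of_append mono_of_Cons ac_simps)
qed

text \<open>The index sum with multiplicity, on monomials because it serves as the rank in
  \<open>resolution_linear_quotients\<close>; on \<open>mono_of xs\<close> it is
  \<open>sum_list xs\<close>.\<close>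

definition weight :: "monomial \<Rightarrow> nat"
  where "weight u = (\<Sum>i\<in>Poly_Mapping.keys u. i * Poly_Mapping.lookup u i)"

lemma weight_add: "weight (u + v) = weight u + weight v"
proof -
  let ?X = "Poly_Mapping.keys u \<union> Poly_Mapping.keys v"
  have alt: "weight w = (\<Sum>i\<in>?X. i * Poly_Mapping.lookup w i)" if "Poly_Mapping.keys w \<subseteq> ?X" for w
    unfolding weight_def using that by (intro sum.mono_neutral_left) (auto simp: in_keys_iff)
  show ?thesis
    by (simp add: alt keys_add_nat lookup_add sum.distrib distrib_left)
qed

lemma weight_mono_of: "weight (mono_of xs) = sum_list xs"
  by (induction xs) (simp_all add: mono_of_Cons weight_add, simp_all add: weight_def)

lemma spread_distinct:
  assumes "t \<ge> 1" "spread t n xs"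
  shows "distinct xs"
proof -
  have "xs ! j < xs ! Suc j" if "Suc j < length xs" for j
    using spreadD(3)[OF assms(2) that] assms(1) by simp
  then have "sorted_wrt (<) xs" by (simp add: sorted_wrt_iff_nth_Suc_transp)
  then show ?thesis by (simp add: strict_sorted_iff)
qed

lemma spread_lower: "spread t n xs \<Longrightarrow> j < length xs \<Longrightarrow> 1 + j * t \<le> xs ! j"
proof (induction j)
  case (Suc j)
  then show ?case using spreadD(3)[of t n xs j] by simp
qed (use spreadD in force)

lemma spread_upper: "spread t n xs \<Longrightarrow> j < length xs \<Longrightarrow> xs ! (length xs - Suc j) + j * t \<le> n"
proof (induction j)
  case (Suc j)
  then have "xs ! (length xs - Suc (Suc j)) + t \<le> xs ! Suc (length xs - Suc (Suc j))"
    by (intro spreadD(3)) auto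
  moreover have "Suc (length xs - Suc (Suc j)) = length xs - Suc j" using Suc.prems by simp
  ultimately show ?case using Suc by simp
qed (use spreadD in force)

lemma spread_take: "spread t n xs \<Longrightarrow> spread t n (take m xs)"
  by (auto simp: spread_iff)

text \<open>Indices of \<open>bs\<close> are replaced by those of \<open>as\<close> one at a time,
  each replacement being a single strong stability move. Working from the left keeps every
  intermediate list spread: at the junction,
  \<open>as ! j + t \<le> as ! Suc j \<le> bs ! Suc j\<close>.\<close>

lemma stable_lower:
  assumes stable: "tspread_strongly_stable t n I"
    and as: "spread t n as" and bs: "spread t n bs" and len: "length as = length bs"
    and le: "\<And>j. j < length as \<Longrightarrow> as ! j \<le> bs ! j" and mem: "mono_poly (mono_of bs) \<in> I"
  shows "mono_poly (mono_of as) \<in> I"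
proof -
  define c where "c p = take p as @ drop p bs" for p
  have nth_c: "c p ! j = (if j < p then as ! j else bs ! j)" if "p \<le> length as" "j < length as" for p j
    using that len by (auto simp: c_def nth_append)
  have len_c: "length (c p) = length as" if "p \<le> length as" for p
    using that len by (simp add: c_def)
  have spread_c: "spread t n (c p)" if p: "p \<le> length as" for p
    unfolding spread_iff len_c[OF p]
  proof (intro conjI allI impI)
    fix j assume "Suc j < length as"
    then show "c p ! j + t \<le> c p ! Suc j"
      using spreadD(3)[OF as, of j] spreadD(3)[OF bs, of j] le[of "Suc j"] len
      by (auto simp: nth_c[OF p])
  qed (use spreadD[OF as] spreadD[OF bs] len in \<open>auto simp: nth_c[OF p]\<close>)
  have "mono_poly (mono_of (c p)) \<in> I" if "p \<le> length as" for p
    using that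
  proof (induction p)
    case 0
    then show ?case using mem by (simp add: c_def)
  next
    case (Suc p)
    then have p: "p < length as" "p < length bs" using len by auto
    let ?xs = "mono_of (take p as) + mono_of (drop (Suc p) bs)"
    have c: "mono_of (c p) = ?xs + Poly_Mapping.single (bs ! p) 1"
      using p by (simp add: c_def mono_of_append mono_of_Cons ac_simps flip: Cons_nth_drop_Suc)
    have c': "mono_of (c (Suc p)) = ?xs + Poly_Mapping.single (as ! p) 1"
      using p by (simp add: c_def mono_of_append mono_of_Cons take_Suc_conv_app_nth ac_simps)
    show ?case
    proof (cases "as ! p = bs ! p")
      case True
      then show ?thesis using Suc c c' by simp
    next
      case False
      then have less: "as ! p < bs ! p" using le[OF p(1)] by simp
      have swap: "mono_of (c p) - Poly_Mapping.single (bs ! p) 1 + Poly_Mapping.single (as ! p) 1 = mono_of (c (Suc p))"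
        unfolding c c' by simp
      have "bs ! p \<in> Poly_Mapping.keys (mono_of (c p))" unfolding c by (simp add: keys_add_nat)
      moreover have "spread t n (c p)" "spread t n (c (Suc p))"
        using spread_c Suc.prems by simp_all
      then have "tspread t n (mono_of (c p))" "tspread t n (mono_of (c (Suc p)))"
        unfolding tspread_iff by blast+
      ultimately show ?thesis
        using stable Suc less spreadD(1)[OF as p(1)] swap unfolding tspread_strongly_stable_def by (metis Suc_leD)
    qed
  qed
  from this[of "length as"] show ?thesis using len by (simp add: c_def)
qed

text \<open>The smallest index at which \<open>bs\<close> is below \<open>as\<close> provides the exchange; if there is none,
  then a prefix of \<open>as\<close> already lies in the ideal.\<close>

lemma stable_quotients:
  assumes t: "t \<ge> 1" and stable: "tspread_strongly_stable t n I"
    and as: "spread t n as" "mono_poly (mono_of as) \<in> I"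
    and bs: "spread t n bs" "mono_poly (mono_of bs) \<in> I"
    and neq: "as \<noteq> bs" and weight: "sum_list bs \<le> sum_list as"
  shows "\<exists>cs. spread t n cs \<and> mono_poly (mono_of cs) \<in> I \<and> length cs \<le> length as \<and> sum_list cs < sum_list as \<and>
    (mono_dvd (mono_of cs) (mono_of as) \<or>
      (\<exists>q. mono_dvd (mono_of cs) (mono_of as + Poly_Mapping.single q 1) \<and>
        Poly_Mapping.lookup (mono_of as) q < Poly_Mapping.lookup (mono_of bs) q))"
proof (cases "\<exists>i. i < length as \<and> i < length bs \<and> bs ! i < as ! i")
  case True
  define i where "i = (LEAST i. i < length as \<and> i < length bs \<and> bs ! i < as ! i)"
  have i: "i < length as" "i < length bs" "bs ! i < as ! i"
    using LeastI_ex[OF True] by (auto simp: i_def)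
  have before: "as ! j \<le> bs ! j" if "j < i" for j
    using not_less_Least[of j "\<lambda>i. i < length as \<and> i < length bs \<and> bs ! i < as ! i"] that i
    by (auto simp: i_def)
  define cs where "cs = as[i := bs ! i]"
  have cs: "spread t n cs"
    unfolding spread_iff
  proof (intro conjI allI impI)
    fix j assume "Suc j < length cs"
    then have j: "Suc j < length as" by (simp add: cs_def)
    have "cs ! Suc i = as ! Suc i" by (simp add: cs_def)
    consider "Suc j = i" | "j = i" | "j \<noteq> i" "Suc j \<noteq> i" by blast
    then show "cs ! j + t \<le> cs ! Suc j"
    proof cases
      case 1
      \<comment> \<open>Minimality of \<open>i\<close> secures the gap to the left of the replaced
        entry: \<open>as ! j + t \<le> bs ! j + t \<le> bs ! i\<close>. To its right, lowering an
        entry only widens the gap.\<close>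
      then show ?thesis using before[of j] spreadD(3)[OF bs(1), of j] i j by (auto simp: cs_def)
    next
      case 2
      then show ?thesis using spreadD(3)[OF as(1), of j] i j by (auto simp: cs_def)
    next
      case 3
      then show ?thesis using spreadD(3)[OF as(1), of j] j by (auto simp: cs_def)
    qed
  qed (use spreadD[OF as(1)] spreadD[OF bs(1)] i in \<open>auto simp: cs_def nth_list_update\<close>)
  have "mono_poly (mono_of cs) \<in> I"
    by (rule stable_lower[OF stable cs as(1) _ _ as(2)]) (use i in \<open>auto simp: cs_def nth_list_update\<close>)
  moreover have swap: "mono_of cs + Poly_Mapping.single (as ! i) 1 = mono_of as + Poly_Mapping.single (bs ! i) 1"
    unfolding cs_def by (rule mono_of_update[OF i(1)])
  have "sum_list cs < sum_list as"
    using arg_cong[OF swap, of weight] i by (simp add: weight_add weight_mono_of) (simp add: weight_def)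
  moreover have "mono_dvd (mono_of cs) (mono_of as + Poly_Mapping.single (bs ! i) 1)"
    by (metis swap mono_dvd_add_right)
  \<comment> \<open>Otherwise the spread list \<open>cs\<close> would contain this index twice. So
    the exchanged variable does not divide the monomial of \<open>as\<close>, as the exponent
    inequality demands.\<close>
  moreover have "bs ! i \<notin> set as"
  proof
    assume "bs ! i \<in> set as"
    then obtain j where j: "j < length as" "as ! j = bs ! i" by (auto simp: in_set_conv_nth)
    then have "cs ! j = cs ! i" using i by (auto simp: cs_def nth_list_update)
    then have "j = i"
      using spread_distinct[OF t cs] i j nth_eq_iff_index_eq by (fastforce simp: cs_def)
    then show False using i j by simp
  qed
  then have "Poly_Mapping.lookup (mono_of as) (bs ! i) < Poly_Mapping.lookup (mono_of bs) (bs ! i)"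
    using i count_list_0_iff[of as "bs ! i"] count_list_0_iff[of bs "bs ! i"]
    by (simp add: lookup_mono_of)
  ultimately show ?thesis using cs by (intro exI[of _ cs]) (auto simp: cs_def)
next
  case False
  then have ge: "as ! j \<le> bs ! j" if "j < length as" "j < length bs" for j
    using that by (meson not_less)
  have pos: "0 < sum_list (drop m xs)" if "spread t n xs" "m < length xs" for m xs
    using spreadD(1)[OF that] that(2) by (auto simp: Cons_nth_drop_Suc[symmetric])
  have split: "sum_list (take m xs) + sum_list (drop m xs) = sum_list xs" for m and xs :: "nat list"
    by (simp flip: sum_list_append)
  let ?m = "length bs"
  have sum_le: "sum_list (take m as) \<le> sum_list (take m bs)" if "m \<le> length as" "m \<le> ?m" for m
    using that ge by (intro sum_list_mono2) auto
  \<comment> \<open>A longer \<open>bs\<close> that dominates \<open>as\<close> entrywise would have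
    the larger sum, since its extra indices are positive; this contradicts the weight
    assumption.\<close>
  have len: "?m \<le> length as"
  proof (rule ccontr)
    assume "\<not> ?m \<le> length as"
    then show False
      using sum_le[of "length as"] split[of "length as" bs] pos[OF bs(1), of "length as"] weight by simp
  qed
  have mem: "mono_poly (mono_of (take ?m as)) \<in> I"
    by (rule stable_lower[OF stable spread_take[OF as(1)] bs(1) _ _ bs(2)]) (use ge len in auto)
  \<comment> \<open>With equal lengths, entrywise domination and the weight bound would force
    \<open>as = bs\<close>. So the prefix is proper and has strictly smaller weight.\<close>
  have "?m \<noteq> length as"
  proof
    assume eq: "?m = length as"
    have "sum_list as = sum_list bs" using sum_le[of ?m] weight eq by simp
    then have "(\<Sum>j<length as. as ! j) = (\<Sum>j<length as. bs ! j)"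
      using eq by (simp add: sum_list_sum_nth lessThan_atLeast0)
    then have "as ! j = bs ! j" if "j < length as" for j
      using sum_mono_inv[of "(!) as" "{..<length as}" "(!) bs" j] ge eq that by auto
    then show False using neq eq by (auto intro: nth_equalityI)
  qed
  then have "sum_list (take ?m as) < sum_list as"
    using split[of ?m as] pos[OF as(1), of ?m] len by simp
  then show ?thesis
    using spread_take[OF as(1), of ?m] mem mono_dvd_take by (intro exI[of _ "take ?m as"]) auto
qed

section \<open>Betti numbers and corners\<close>

lemma monomial_ideal_cong:
  assumes "\<And>u. u \<in> U \<Longrightarrow> \<exists>w\<in>W. mono_dvd w u" "\<And>w. w \<in> W \<Longrightarrow> \<exists>u\<in>U. mono_dvd u w"
  shows "monomial_ideal n U = monomial_ideal n W"
  using assms mono_dvd_trans unfolding monomial_ideal_def by blast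

lemma betti_stable_generated_eq_0:
  fixes I :: "'k::field mpoly set"
  assumes t: "t \<ge> 1" and stable: "tspread_strongly_stable t n I"
    and gen: "\<And>xs. spread t n xs \<Longrightarrow> mono_poly (mono_of xs) \<in> I \<Longrightarrow>
      \<exists>ys. spread t n ys \<and> mono_poly (mono_of ys) \<in> I \<and> length ys \<le> D \<and> mono_dvd (mono_of ys) (mono_of xs)"
    and nz: "betti n I i (i + l) \<noteq> 0"
  shows "\<exists>xs. spread t n xs \<and> mono_poly (mono_of xs) \<in> I \<and> length xs = l \<and> l \<le> D"
proof -
  \<comment> \<open>All t-spread monomials of \<open>I\<close> up to degree \<open>D\<close> are
    taken, because this set is closed under the exchanges of \<open>stable_quotients\<close>: they
    stay in \<open>I\<close> and do not increase the length.\<close>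
  define U where "U = mono_of ` {xs. spread t n xs \<and> mono_poly (mono_of xs) \<in> I \<and> length xs \<le> D}"
  have keys_U: "Poly_Mapping.keys u \<subseteq> {1..n}" if "u \<in> U" for u
    using that by (auto simp: U_def spread_def)
  obtain U0 where U0: "U0 \<subseteq> {u. tspread t n u}" and I: "I = Idl\<^bsub>poly_ring n\<^esub> (mono_poly ` U0)"
    using stable unfolding tspread_strongly_stable_def tspread_monomial_ideal_def by blast
  have "Poly_Mapping.keys u \<subseteq> {1..n}" if "u \<in> U0" for u
    using that U0 by (auto simp: tspread_iff spread_def subset_iff)
  then have I0: "I = monomial_ideal n U0" and keys_U0: "\<And>u. u \<in> U0 \<Longrightarrow> Poly_Mapping.keys u \<subseteq> {1..n}"
    unfolding I using genideal_eq_monomial_ideal by blast+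
  have "monomial_ideal n U0 = (monomial_ideal n U :: 'k mpoly set)"
  proof (rule monomial_ideal_cong)
    fix u assume u: "u \<in> U0"
    then obtain xs where xs: "spread t n xs" "u = mono_of xs" using U0 by (auto simp: tspread_iff)
    have "mono_poly u \<in> I"
      unfolding I0 mono_poly_mem_monomial_ideal using keys_U0 u mono_dvd_refl by blast
    then show "\<exists>w\<in>U. mono_dvd w u" using gen xs unfolding U_def by blast
  next
    fix w assume "w \<in> U"
    then have "mono_poly w \<in> I" by (auto simp: U_def)
    then show "\<exists>u\<in>U0. mono_dvd u w" unfolding I0 mono_poly_mem_monomial_ideal by blast
  qed
  then have I_U: "I = monomial_ideal n U" using I0 by simp
  have "{xs. spread t n xs \<and> mono_poly (mono_of xs) \<in> I \<and> length xs \<le> D} \<subseteq> {xs. set xs \<subseteq> {1..n} \<and> length xs \<le> D}"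
    by (auto simp: spread_def)
  then have fin: "finite U"
    unfolding U_def using finite_lists_length_le[of "{1..n}" D] by (blast intro: finite_subset)
  have "\<exists>a A. graded_free_resolution n (monomial_ideal n U :: 'k mpoly set) a A \<and>
    (\<forall>i. \<forall>e\<in>set (a i). \<exists>u\<in>U. e = mdeg u + i)"
  proof (rule resolution_linear_quotients[OF fin keys_U, where f = weight])
    fix u v assume u: "u \<in> U" and v: "v \<in> U" and "v \<noteq> u" "weight v \<le> weight u"
    then obtain as bs where as: "u = mono_of as" "spread t n as" "mono_poly (mono_of as) \<in> I" "length as \<le> D"
      and bs: "v = mono_of bs" "spread t n bs" "mono_poly (mono_of bs) \<in> I"
      by (auto simp: U_def)
    obtain cs where cs: "spread t n cs" "mono_poly (mono_of cs) \<in> I" "length cs \<le> length as"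
        "sum_list cs < sum_list as"
        "mono_dvd (mono_of cs) u \<or> (\<exists>q. mono_dvd (mono_of cs) (u + Poly_Mapping.single q 1) \<and>
          Poly_Mapping.lookup u q < Poly_Mapping.lookup v q)"
      using stable_quotients[OF t stable as(2,3) bs(2,3)] \<open>v \<noteq> u\<close> \<open>weight v \<le> weight u\<close>
      unfolding as(1) bs(1) weight_mono_of by blast
    have "mono_of cs \<in> U" using cs as(4) by (auto simp: U_def)
    moreover have "weight (mono_of cs) < weight u" using cs(4) by (simp add: as(1) weight_mono_of)
    ultimately show "\<exists>w\<in>U. weight w < weight u \<and> (mono_dvd w u \<or>
        (\<exists>q. mono_dvd w (u + Poly_Mapping.single q 1) \<and> Poly_Mapping.lookup u q < Poly_Mapping.lookup v q))"
      using cs(5) by blast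
  qed
  then obtain a A where res: "graded_free_resolution n I a A"
    and a: "\<And>e. e \<in> set (a i) \<Longrightarrow> \<exists>u\<in>U. e = mdeg u + i"
    unfolding I_U by blast
  have "i + l \<in> set (a i)" using betti_eq_0[OF res, of "i + l" i] nz by blast
  then obtain u where "u \<in> U" "l = mdeg u" using a by force
  then show ?thesis by (auto simp: U_def)
qed

lemma corners_card_le:
  fixes I :: "'k::field mpoly set"
  assumes "\<And>i l. betti n I i (i + l) \<noteq> 0 \<Longrightarrow> l \<in> {m..D}"
  shows "finite (corners n I) \<and> card (corners n I) \<le> Suc D - m"
proof -
  have inj: "inj_on snd (corners n I)"
  proof (rule inj_onI)
    fix x y assume x: "x \<in> corners n I" and y: "y \<in> corners n I" and eq: "snd x = snd y"
    \<comment> \<open>If \<open>k < k'\<close>, the nonzero Betti number at \<open>(k', l)\<close>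
      would violate the extremality of \<open>(k, l)\<close>.\<close>
    have max: "k' \<le> k" if "(k, l) \<in> corners n I" "(k', l) \<in> corners n I" for k k' l
      using that unfolding corners_def by (auto simp: not_less[symmetric])
    show "x = y" using max[of "fst x" "snd x" "fst y"] max[of "fst y" "snd x" "fst x"] x y eq
      by (simp add: prod_eq_iff) (metis prod.collapse le_antisym)
  qed
  have sub: "snd ` corners n I \<subseteq> {m..D}"
    using assms unfolding corners_def by auto
  then have "finite (corners n I)" using inj finite_imageD finite_subset by blast
  moreover have "card (corners n I) \<le> card {m..D}"
    using card_mono[OF _ sub] card_image[OF inj] by simp
  ultimately show ?thesis by simp
qed

text \<open>A term of a nonzero form of least degree is divisible by a t-spread generator. That
  generator has at most the same degree, and by minimality at least that degree, so the initial
  degree is attained by a t-spread monomial.\<close>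

lemma initial_degree_stable:
  fixes I :: "'k::field mpoly set"
  assumes stable: "tspread_strongly_stable t n I" and nz: "I \<noteq> {0}"
  shows "\<exists>xs. spread t n xs \<and> mono_poly (mono_of xs) \<in> I \<and> length xs = initial_degree I"
    and "mono_poly u \<in> I \<Longrightarrow> initial_degree I \<le> mdeg u"
proof -
  obtain U where U: "U \<subseteq> {u. tspread t n u}" and I: "I = Idl\<^bsub>poly_ring n\<^esub> (mono_poly ` U)"
    using stable unfolding tspread_strongly_stable_def tspread_monomial_ideal_def by blast
  have keys_U: "Poly_Mapping.keys u \<subseteq> {1..n}" if "u \<in> U" for u
    using that U by (auto simp: tspread_iff spread_def subset_iff)
  then have I_U: "I = monomial_ideal n U"
    unfolding I using genideal_eq_monomial_ideal by blast
  have mem: "mono_poly u \<in> I" if "u \<in> U" for u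
    unfolding I_U mono_poly_mem_monomial_ideal using keys_U that mono_dvd_refl by blast
  have comp: "graded_component I (mdeg u) \<noteq> {0}" if "mono_poly u \<in> I" for u
  proof -
    have "mono_poly u \<in> graded_component I (mdeg u)" using that by (simp add: graded_component_def)
    moreover have "mono_poly u \<noteq> (0 :: 'k mpoly)" by (metis lookup_single_eq lookup_zero one_neq_zero)
    ultimately show ?thesis by auto
  qed
  show le: "initial_degree I \<le> mdeg u" if "mono_poly u \<in> I" for u
    unfolding initial_degree_def by (rule Least_le) (rule comp[OF that])
  have zero: "0 \<in> graded_component I j" for j
    by (simp add: graded_component_def I_U monomial_ideal_def)
  have "U \<noteq> {}" using nz by (auto simp: I_U monomial_ideal_empty)
  then obtain j where "graded_component I j \<noteq> {0}" using comp mem by blast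
  then have "graded_component I (initial_degree I) \<noteq> {0}"
    unfolding initial_degree_def by (rule LeastI)
  then obtain p where p: "p \<in> graded_component I (initial_degree I)" "p \<noteq> 0" using zero by blast
  then obtain m where m: "m \<in> Poly_Mapping.keys p" by (metis all_not_in_conv keys_eq_empty)
  then have "mdeg m = initial_degree I" using p(1) by (simp add: graded_component_def)
  moreover obtain g where g: "g \<in> U" "mono_dvd g m"
    using m p(1) by (auto simp: graded_component_def I_U monomial_ideal_def)
  ultimately have "mdeg g = initial_degree I"
    using mdeg_mono[OF g(2)] le[OF mem[OF g(1)]] by simp
  moreover obtain xs where "spread t n xs" "g = mono_of xs"
    using U g(1) by (auto simp: tspread_iff)
  ultimately show "\<exists>xs. spread t n xs \<and> mono_poly (mono_of xs) \<in> I \<and> length xs = initial_degree I"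
    using mem[OF g(1)] by auto
qed

section \<open>The range of possible corner degrees and the count\<close>

theorem theorem5p1:
  fixes n t k d l1 :: nat and I :: "'k::field mpoly set"
  assumes "n \<ge> 2" and "t \<ge> 2" and "k \<ge> 3"
    and "n = d + k * t" and "1 \<le> d" and "d \<le> t"
    and "3 \<le> l1" and "int l1 \<le> int k + \<lfloor>(real d - 2) / real t\<rfloor> + 1"
    and "I \<in> unit_extremal_ideals t n"
    and "I \<noteq> {0}" and "initial_degree I = l1"
    and "\<exists>k1. (k1, l1) \<in> corners n I"
  shows "finite (corners n I) \<and>
    int (card (corners n I)) \<le> int k + \<lfloor>(real d - 2) / real t\<rfloor> - (int l1 - 2)"
proof -
  have stable: "tspread_strongly_stable t n I"
    using assms(9) by (simp add: unit_extremal_ideals_def)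
  \<comment> \<open>The largest degree in which a needed t-spread generator can occur.\<close>
  define D where "D = (if d = 1 then k else Suc k)"
  \<comment> \<open>For \<open>d = 1\<close> the quotient is \<open>-1/t\<close>, with floor -1; for
    \<open>2 \<le> d \<le> t\<close> it lies in [0,1), with floor 0.\<close>
  have floor: "\<lfloor>(real d - 2) / real t\<rfloor> = int D - int k - 1"
  proof (cases "d = 1")
    case True
    then show ?thesis using assms(2) by (simp add: D_def floor_eq_iff field_simps)
  next
    case False
    then have "2 \<le> d" using assms(5) by simp
    then show ?thesis using False assms(2,6) by (simp add: D_def floor_eq_iff field_simps)
  qed
  then have l1D: "l1 \<le> D" using assms(8) by simp
  obtain gs where gs: "spread t n gs" "mono_poly (mono_of gs) \<in> I" "length gs = l1"
    using initial_degree_stable(1)[OF stable assms(10)] assms(11) by blast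
  have "\<exists>ys. spread t n ys \<and> mono_poly (mono_of ys) \<in> I \<and> length ys \<le> D \<and> mono_dvd (mono_of ys) (mono_of xs)"
    if xs: "spread t n xs" "mono_poly (mono_of xs) \<in> I" for xs
  proof (cases "length xs \<le> D")
    case True
    then show ?thesis using xs mono_dvd_refl by blast
  next
    case False
    have len: "length xs \<le> Suc k"
    proof (rule ccontr)
      assume "\<not> length xs \<le> Suc k"
      \<comment> \<open>The index at position \<open>k + 1\<close> (counting from 0) would be at
        least \<open>1 + (k + 1) * t\<close>, which exceeds \<open>d + k * t\<close> because
        \<open>d \<le> t\<close>.\<close>
      then have "1 + Suc k * t \<le> n"
        using spread_lower[OF xs(1), of "Suc k"] spreadD(2)[OF xs(1), of "Suc k"] by linarith
      then show False using assms(4,6) by simp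
    qed
    then have d1: "d = 1" and len: "length xs = Suc k" using False by (auto simp: D_def split: if_splits)
    \<comment> \<open>Now \<open>n = 1 + k * t\<close>, and the gaps above position \<open>j\<close>
      leave no slack: each index is at its least possible value. Hence the first \<open>l1\<close>
      indices are bounded by those of any spread list of length \<open>l1\<close>, in particular by
      those of \<open>gs\<close>.\<close>
    have min: "xs ! j \<le> 1 + j * t" if "j \<le> k" for j
    proof -
      have "xs ! j + (k - j) * t \<le> n"
        using spread_upper[OF xs(1), of "k - j"] that len by simp
      moreover have "(k - j) * t + j * t = k * t" using that by (simp flip: add_mult_distrib)
      ultimately show ?thesis using assms(4) d1 by linarith
    qed
    have "l1 \<le> k" using l1D d1 by (simp add: D_def)
    have "mono_poly (mono_of (take l1 xs)) \<in> I"
    proof (rule stable_lower[OF stable spread_take[OF xs(1)] gs(1) _ _ gs(2)])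
      show "length (take l1 xs) = length gs" using gs(3) len \<open>l1 \<le> k\<close> by simp
      show "take l1 xs ! j \<le> gs ! j" if "j < length (take l1 xs)" for j
        using that min[of j] spread_lower[OF gs(1), of j] gs(3) \<open>l1 \<le> k\<close> by simp
    qed
    then show ?thesis
      using spread_take[OF xs(1), of l1] l1D mono_dvd_take
      by (intro exI[of _ "take l1 xs"]) auto
  qed
  then have "l \<in> {l1..D}" if "betti n I i (i + l) \<noteq> 0" for i l
    using betti_stable_generated_eq_0[OF _ stable _ that, of D] assms(2)
      initial_degree_stable(2)[OF stable assms(10)] assms(11) by fastforce
  then have "finite (corners n I) \<and> card (corners n I) \<le> Suc D - l1"
    by (rule corners_card_le)
  \<comment> \<open>\<open>l1 \<le> D\<close> makes the natural subtraction
    \<open>Suc D - l1\<close> exact, and it then agrees with the integer bound.\<close>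
  then show ?thesis unfolding floor using l1D by auto
qed

end
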